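(* Let $G$ be a connected graph of order $n\ge 4$ and diameter $D$ with $3\le D\le n-1$. Then $\xi^c(G)\le f(n,D)$, with equality if and only if $G$ is isomorphic to a graph in the class $\mathcal{C}_n^D$, where \[ \mathcal{C}_n^D= \begin{cases} \{G_{n,3,n-4}\} & \text{if } n\in\{4,5\},\ D=3;\\ \{G_{6,3,2},H_2\} & \text{if } n=6,\ D=3;\\ \{G_{7,3,0},G_{7,3,1},G_{7,3,2},G_{7,3,3},H_3\} & \text{if } n=7,\ D=3;\\ \{G_{n,3,0}\} & \text{if } n>7,\ D=3;\\ \{G_{n,D,n-D-1}\} & \text{if } n<3(D-1),\ D\ge4;\\ \{G_{n,D,0},\ldots,G_{n,D,n-D-1}\} & \text{if } n=3(D-1),\ D\ge4;\\ \{G_{n,D,0}\} & \text{if } n>3(D-1),\ D\ge4. \end{cases} \]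
   Context: Graphs are simple, finite, undirected. For a connected graph $G=(V,E)$, $\mathrm{ecc}(v)=\max_{w\in V}\mathrm{dist}(v,w)$, the diameter is the maximum eccentricity, and $\xi^c(G)=\sum_{v\in V}\deg(v)\,\mathrm{ecc}(v)$. For integers $n\ge4$, $3\le D\le n-1$, $0\le k\le n-D-1$, the graph $G_{n,D,k}$ is constructed from a path $u_0-u_1-\cdots-u_D$ and a disjoint clique $K_{n-D-1}$ by joining every vertex of the clique to $u_0$ and $u_1$, and joining $k$ of the clique vertices to $u_2$; it has order $n$ and diameter $D$. Define $f(n,D)=\max_{0\le k\le n-D-1}\xi^c(G_{n,D,k})$. $H_2$ is the graph on $6$ vertices consisting of a path $u_0-u_1-u_2-u_3$ and two adjacent vertices $x,y$, where $x$ is adjacent to $u_0,u_1,u_2$ and $y$ is adjacent to $u_1,u_2,u_3$. $H_3$ is the graph on $7$ vertices obtained from a complete graph $K_5$ on vertices $\{1,2,3,4,5\}$ by adding a vertex $a$ adjacent to exactly $1,2,3$ and a vertex $b$ adjacent to exactly $4,5$. *)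

theory Defs
  imports "Graph_Theory.Graph_Theory"
begin

text \<open>Simple finite undirected graphs are the \<^locale>\<open>pair_graph\<close>s of the library: finite, loop-free
  digraphs with a symmetric set of arcs. An undirected edge is a pair of opposite arcs, so the
  degree of a vertex is its out-degree.\<close>

definition gdist :: "('a, 'b) pre_digraph \<Rightarrow> 'a \<Rightarrow> 'a \<Rightarrow> nat" where
  "gdist G u v = (LEAST k. \<exists>p. pre_digraph.awalk G u p v \<and> length p = k)"

lemma (in wf_digraph) ereal_gdist_eq_\<mu>:
  assumes "u \<rightarrow>\<^sup>* v"
  shows "ereal (real (gdist G u v)) = \<mu> (\<lambda>_. 1) u v"
proof -
  have cost: "awalk_cost (\<lambda>_. 1) p = real (length p)" for p :: "'b awalk"
    by (induction p) auto
  let ?P = "\<lambda>k. \<exists>p. awalk u p v \<and> length p = k"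
  from assms obtain q where "awalk u q v" by (auto simp: reachable_awalk)
  then have "?P (length q)" by blast
  then have "?P (gdist G u v)" unfolding gdist_def by (rule LeastI)
  then obtain p where p: "awalk u p v" "length p = gdist G u v" by blast
  have "gdist G u v \<le> length r" if "awalk u r v" for r
    unfolding gdist_def using that by (intro Least_le) blast
  with p show ?thesis
    unfolding \<mu>_def cost by (intro antisym INF_greatest INF_lower2[of p]) auto
qed

definition ecc :: "('a, 'b) pre_digraph \<Rightarrow> 'a \<Rightarrow> nat" where
  "ecc G v = Max (gdist G v ` verts G)"

definition graph_diameter :: "('a, 'b) pre_digraph \<Rightarrow> nat" where
  "graph_diameter G = Max (ecc G ` verts G)"

definition ecc_conn_index :: "('a, 'b) pre_digraph \<Rightarrow> nat" where
  "ecc_conn_index G = (\<Sum>v\<in>verts G. out_degree G v * ecc G v)"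

text \<open>The path vertex \<open>u\<^sub>i\<close> is \<open>i\<close> for \<open>i \<le> D\<close>, the clique is \<open>{D<..<n}\<close>, and the clique vertices joined
  to \<open>u\<^sub>2\<close> are \<open>{D<..D + k}\<close>.\<close>

definition G_graph :: "nat \<Rightarrow> nat \<Rightarrow> nat \<Rightarrow> nat pair_pre_digraph" where
  "G_graph n D k = mk_symmetric (with_proj
     \<lparr> pverts = {..<n},
       parcs = {(i, Suc i) | i. i < D}
             \<union> {(x, y) | x y. D < x \<and> x < y \<and> y < n}
             \<union> {D<..<n} \<times> {0, 1}
             \<union> {D<..D + k} \<times> {2} \<rparr>)"

definition f_max :: "nat \<Rightarrow> nat \<Rightarrow> nat" where
  "f_max n D = Max ((\<lambda>k. ecc_conn_index (with_proj (G_graph n D k))) ` {0..n - D - 1})"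

text \<open>In \<open>H2\<close>, \<open>u\<^sub>i\<close> is \<open>i\<close>, \<open>x\<close> is \<open>4\<close> and \<open>y\<close> is \<open>5\<close>; in \<open>H3\<close>, \<open>a\<close> is \<open>6\<close> and \<open>b\<close> is \<open>7\<close>.\<close>

definition H2 :: "nat pair_pre_digraph" where
  "H2 = mk_symmetric (with_proj
     \<lparr> pverts = {0..5},
       parcs = {(0, 1), (1, 2), (2, 3), (4, 5)} \<union> {4} \<times> {0, 1, 2} \<union> {5} \<times> {1, 2, 3} \<rparr>)"

definition H3 :: "nat pair_pre_digraph" where
  "H3 = mk_symmetric (with_proj
     \<lparr> pverts = {1..7},
       parcs = {(i, j) | i j. 1 \<le> i \<and> i < j \<and> j \<le> 5} \<union> {6} \<times> {1, 2, 3} \<union> {7} \<times> {4, 5} \<rparr>)"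

text \<open>The value \<open>{}\<close> is only taken outside the range \<open>3 \<le> D \<le> n - 1\<close>.\<close>

definition extremal_class :: "nat \<Rightarrow> nat \<Rightarrow> nat pair_pre_digraph set" where
  "extremal_class n D =
    (if n \<in> {4, 5} \<and> D = 3 then {G_graph n 3 (n - 4)}
     else if n = 6 \<and> D = 3 then {G_graph 6 3 2, H2}
     else if n = 7 \<and> D = 3 then {G_graph 7 3 0, G_graph 7 3 1, G_graph 7 3 2, G_graph 7 3 3, H3}
     else if n > 7 \<and> D = 3 then {G_graph n 3 0}
     else if n < 3 * (D - 1) \<and> D \<ge> 4 then {G_graph n D (n - D - 1)}
     else if n = 3 * (D - 1) \<and> D \<ge> 4 then G_graph n D ` {0..n - D - 1}
     else if n > 3 * (D - 1) \<and> D \<ge> 4 then {G_graph n D 0}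
     else {})"

end

theory Submission
  imports Defs
begin

text \<open>
  Fix a geodesic \<open>u\<^sub>0, \<dots>, u\<^sub>D\<close> of maximal length and let \<open>m = n - D - 1\<close> be the number of remaining vertices.
  Charging each edge between the path and a remaining vertex \<open>v\<close> to \<open>v\<close>, the index becomes
  \<open>\<Sum>\<^sub>j deg\<^sub>P(u\<^sub>j) ecc(u\<^sub>j) + \<Sum>\<^sub>v c(v)\<close> with \<open>c(v) = \<Sum>\<^bsub>u\<^sub>j ~ v\<^esub> ecc(u\<^sub>j) + deg(v) ecc(v)\<close>.

  A remaining vertex has its path neighbours among three consecutive path vertices. If \<open>ecc(u\<^sub>j)\<close> equals
  \<open>max j (D - j)\<close> for all \<open>j\<close>, then \<open>c(v)\<close> is at most \<open>A = 2D - 1 + (m + 1)D\<close> when \<open>v\<close> has two path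
  neighbours and at most \<open>B = 2D - 1 + max 2 (D - 2) + (m + 2)(D - 1)\<close> when it has three (a vertex with three
  path neighbours and eccentricity \<open>D\<close> has degree at most \<open>m\<close>). These are the contributions of the clique
  vertices of \<open>G\<^bsub>n,D,k\<^esub>\<close>, whose index is therefore \<open>path + kB + (m - k)A\<close>. Equality forces the remaining vertices to
  form a clique attached to the ends of the path; both ends can occur only for \<open>D = 3\<close>, which gives \<open>H\<^sub>2\<close>
  and \<open>H\<^sub>3\<close>.

  If some \<open>ecc(u\<^sub>j)\<close> exceeds \<open>max j (D - j)\<close>, let \<open>r\<close> be the largest excess and \<open>w\<close> a vertex realising it. The path part
  grows by at most \<open>2r(D - 1)\<close>, but the first \<open>r - 1\<close> vertices of a geodesic from \<open>w\<close> to \<open>u\<^sub>j\<close> have no path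
  neighbour (for \<open>r = 1\<close>, \<open>w\<close> has at most one), and this costs more than is gained.
\<close>

section \<open>Graph metrics\<close>

lemma mult_eq_bounds:
  fixes x y a b :: nat
  assumes "x \<le> a" "y \<le> b" "x * y = a * b" "0 < a" "0 < b"
  shows "x = a \<and> y = b"
proof -
  have "x * y \<le> x * b" "x * b \<le> a * b" using assms(1,2) by auto
  then have "x * b = a * b" using assms(3) by (metis le_antisym)
  then have "x = a" using \<open>0 < b\<close> by simp
  then show ?thesis using \<open>x * y = a * b\<close> \<open>0 < a\<close> by simp
qed

text \<open>The distance function of a connected finite graph; adjacency is distance 1.\<close>

locale graph_metric =
  fixes V :: "'a set" and d :: "'a \<Rightarrow> 'a \<Rightarrow> nat"
  assumes finite_V: "finite V"
    and d_eq_0_iff: "\<lbrakk>x \<in> V; y \<in> V\<rbrakk> \<Longrightarrow> d x y = 0 \<longleftrightarrow> x = y"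
    and d_commute: "\<lbrakk>x \<in> V; y \<in> V\<rbrakk> \<Longrightarrow> d x y = d y x"
    and d_triangle: "\<lbrakk>x \<in> V; y \<in> V; z \<in> V\<rbrakk> \<Longrightarrow> d x z \<le> d x y + d y z"
    and d_step: "\<lbrakk>x \<in> V; y \<in> V; d x y = Suc k\<rbrakk> \<Longrightarrow> \<exists>z\<in>V. d x z = 1 \<and> d z y = k"
begin

definition nbrs :: "'a \<Rightarrow> 'a set" where "nbrs x = {y \<in> V. d x y = 1}"
definition deg :: "'a \<Rightarrow> nat" where "deg x = card (nbrs x)"
definition ec :: "'a \<Rightarrow> nat" where "ec x = Max (d x ` V)"
definition xi :: nat where "xi = (\<Sum>x\<in>V. deg x * ec x)"

lemma d_le_ec: "y \<in> V \<Longrightarrow> d x y \<le> ec x"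
  unfolding ec_def using finite_V by auto

lemma ec_attained: "x \<in> V \<Longrightarrow> \<exists>y\<in>V. d x y = ec x"
  unfolding ec_def using Max_in[of "d x ` V"] finite_V by (metis empty_iff finite_imageI imageE image_is_empty)

lemma ec_eqI:
  assumes "y \<in> V" "d x y = k" "\<And>z. z \<in> V \<Longrightarrow> d x z \<le> k"
  shows "ec x = k"
  unfolding ec_def using assms finite_V by (intro Max_eqI) auto

lemma d_self: "x \<in> V \<Longrightarrow> d x x = 0"
  using d_eq_0_iff by blast

lemma geodesic_vertex:
  assumes "x \<in> V" "y \<in> V" "k \<le> d x y"
  shows "\<exists>z\<in>V. d x z = k \<and> d z y = d x y - k"
  using assms(3)
proof (induction k)
  case 0
  then show ?case using assms d_self by auto
next
  case (Suc k)
  then obtain z where z: "z \<in> V" "d x z = k" "d z y = d x y - k" by auto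
  then have "d z y = Suc (d x y - Suc k)" using Suc.prems by auto
  then obtain z' where z': "z' \<in> V" "d z z' = 1" "d z' y = d x y - Suc k"
    using d_step z(1) assms(2) by blast
  have "d x z' \<le> Suc k" "d x y \<le> d x z' + d z' y"
    using d_triangle[of x z z'] d_triangle[of x z' y] z z' assms by auto
  then have "d x z' = Suc k" using z'(3) Suc.prems by linarith
  then show ?case using z' by blast
qed

text \<open>A potential that drops by at most 1 along every edge certifies lower bounds on
  distances, by following a geodesic.\<close>

lemma lipschitz_le_d:
  fixes \<phi> :: "'a \<Rightarrow> nat"
  assumes lip: "\<And>x y. \<lbrakk>x \<in> V; y \<in> V; d x y = 1\<rbrakk> \<Longrightarrow> \<phi> x \<le> Suc (\<phi> y)"
    and "x \<in> V" "y \<in> V"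
  shows "\<phi> x \<le> \<phi> y + d x y"
  using assms(2)
proof (induction "d x y" arbitrary: x)
  case 0
  then show ?case using d_eq_0_iff assms(3) by simp
next
  case (Suc k)
  then obtain z where z: "z \<in> V" "d x z = 1" "d z y = k"
    using d_step assms(3) by metis
  then show ?case using Suc.hyps(1)[of z] lip[of x z] Suc.prems Suc.hyps(2) by auto
qed

end

section \<open>Decomposition along a geodesic\<close>

text \<open>Eccentricity of \<open>u j\<close> measured on the path alone, hence a lower bound for
  its eccentricity in the graph.\<close>

definition path_ecc :: "nat \<Rightarrow> nat \<Rightarrow> nat" where
  "path_ecc D j = max j (D - j)"

definition path_deg :: "nat \<Rightarrow> nat \<Rightarrow> nat" where
  "path_deg D j = (if j = 0 \<or> j = D then 1 else 2)"

definition path_index :: "nat \<Rightarrow> nat" where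
  "path_index D = (\<Sum>j\<le>D. path_deg D j * path_ecc D j)"

text \<open>Contribution of a vertex attached to \<open>u 0\<close>, \<open>u 1\<close> and all
  other remaining vertices: \<open>D + (D - 1)\<close> from the path neighbours, then degree
  \<open>m + 1\<close> times eccentricity \<open>D\<close>.\<close>

definition two_nbr_bound :: "nat \<Rightarrow> nat \<Rightarrow> nat" where
  "two_nbr_bound D m = 2 * D - 1 + (m + 1) * D"

text \<open>The same for path neighbours \<open>u 0\<close>, \<open>u 1\<close>, \<open>u 2\<close>:
  here \<open>max 2 (D - 2)\<close> is \<open>path_ecc D 2\<close>, the degree is
  \<open>m + 2\<close>, and the shortcut to \<open>u 2\<close> lowers the eccentricity to
  \<open>D - 1\<close>.\<close>

definition three_nbr_bound :: "nat \<Rightarrow> nat \<Rightarrow> nat" where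
  "three_nbr_bound D m = 2 * D - 1 + max 2 (D - 2) + (m + 2) * (D - 1)"

definition rest_bound :: "nat \<Rightarrow> nat \<Rightarrow> nat" where
  "rest_bound D m = max (two_nbr_bound D m) (three_nbr_bound D m)"

locale geodesic = graph_metric +
  fixes D :: nat and u :: "nat \<Rightarrow> 'a"
  assumes D3: "3 \<le> D"
    and u_in: "j \<le> D \<Longrightarrow> u j \<in> V"
    and d_u_le: "\<lbrakk>i \<le> j; j \<le> D\<rbrakk> \<Longrightarrow> d (u i) (u j) = j - i"
begin

definition rest :: "'a set" where "rest = V - u ` {..D}"
definition m :: nat where "m = card rest"
definition N :: "'a \<Rightarrow> nat set" where "N v = {j. j \<le> D \<and> d v (u j) = 1}"
definition c :: "'a \<Rightarrow> nat" where "c v = (\<Sum>j\<in>N v. ec (u j)) + deg v * ec v"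

text \<open>The truncated differences add up to |i - j|, because one of them is always 0.\<close>

lemma d_u: "\<lbrakk>i \<le> D; j \<le> D\<rbrakk> \<Longrightarrow> d (u i) (u j) = (i - j) + (j - i)"
  using d_u_le[of i j] d_u_le[of j i] d_commute[of "u i" "u j"] u_in by (cases "i \<le> j") auto

lemma inj_u: "inj_on u {..D}"
proof (rule inj_onI)
  fix i j assume "i \<in> {..D}" "j \<in> {..D}" "u i = u j"
  then have "d (u i) (u j) = 0" using d_eq_0_iff u_in by auto
  then show "i = j" using d_u \<open>i \<in> {..D}\<close> \<open>j \<in> {..D}\<close> by auto
qed

lemma finite_rest: "finite rest" and rest_in: "v \<in> rest \<Longrightarrow> v \<in> V"
  using finite_V by (auto simp: rest_def)

lemma finite_N: "finite (N v)" and N_le: "j \<in> N v \<Longrightarrow> j \<le> D"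
  and N_d: "j \<in> N v \<Longrightarrow> d v (u j) = 1"
  by (auto simp: N_def)

lemma V_eq: "V = u ` {..D} \<union> rest"
  using u_in by (auto simp: rest_def)

lemma card_V: "card V = D + 1 + m"
proof -
  have "card V = card (u ` {..D}) + card rest"
    using finite_rest by (subst V_eq) (intro card_Un_disjoint, auto simp: rest_def)
  then show ?thesis using card_image[OF inj_u] by (simp add: m_def)
qed

lemma V_cases:
  assumes "x \<in> V"
  obtains (path) j where "j \<le> D" "x = u j" | (rest) "x \<in> rest"
  using assms V_eq by auto

text \<open>A geodesic is an induced path, so \<open>u j\<close> is adjacent to no path vertices but
  its predecessor and successor.\<close>

lemma deg_path:
  assumes "j \<le> D"
  shows "deg (u j) = path_deg D j + card {v \<in> rest. d v (u j) = 1}"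
proof -
  let ?I = "{i. i \<le> D \<and> (i = Suc j \<or> j = Suc i)}"
  have "nbrs (u j) = u ` ?I \<union> {v \<in> rest. d v (u j) = 1}"
  proof (intro set_eqI iffI)
    fix x assume x: "x \<in> nbrs (u j)"
    then have "x \<in> V" by (simp add: nbrs_def)
    then show "x \<in> u ` ?I \<union> {v \<in> rest. d v (u j) = 1}"
    proof (cases rule: V_cases)
      case (path i)
      then have "(i - j) + (j - i) = 1" using x d_u[OF assms, of i] by (simp add: nbrs_def)
      then have "i \<in> ?I" using path by auto
      then show ?thesis using path by blast
    next
      case rest
      then show ?thesis using x d_commute u_in assms by (auto simp: nbrs_def)
    qed
  next
    fix x assume "x \<in> u ` ?I \<union> {v \<in> rest. d v (u j) = 1}"
    then show "x \<in> nbrs (u j)"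
      using d_u[OF assms, of "Suc j"] d_u[OF assms, of "j - 1"] u_in assms d_commute[of x "u j"] rest_in
      by (auto simp: nbrs_def)
  qed
  moreover have "card (u ` ?I) = card ?I"
    by (intro card_image inj_on_subset[OF inj_u]) auto
  moreover have "card ?I = path_deg D j"
  proof -
    have "?I = (if j = 0 then {Suc 0} else if j = D then {D - 1} else {j - 1, Suc j})"
      using assms D3 by auto
    then show ?thesis using assms by (auto simp: path_deg_def)
  qed
  moreover have "card (u ` ?I \<union> {v \<in> rest. d v (u j) = 1})
      = card (u ` ?I) + card {v \<in> rest. d v (u j) = 1}"
    using finite_rest by (intro card_Un_disjoint) (auto simp: rest_def)
  ultimately show ?thesis by (simp add: deg_def)
qed

lemma deg_rest:
  assumes "v \<in> rest"
  shows "deg v = card (N v) + card {x \<in> rest. d v x = 1}"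
proof -
  have "nbrs v = u ` N v \<union> {x \<in> rest. d v x = 1}"
    using u_in rest_in by (auto simp: nbrs_def N_def elim!: V_cases)
  moreover have "card (u ` N v) = card (N v)"
    by (intro card_image inj_on_subset[OF inj_u]) (auto simp: N_def)
  moreover have "card (u ` N v \<union> {x \<in> rest. d v x = 1}) = card (u ` N v) + card {x \<in> rest. d v x = 1}"
    using finite_rest by (intro card_Un_disjoint) (auto simp: rest_def N_def)
  ultimately show ?thesis by (simp add: deg_def)
qed

text \<open>\<open>{v}\<close>, the neighbours of \<open>v\<close> in \<open>rest\<close> and
  \<open>S\<close> are disjoint subsets of \<open>rest\<close>, so each known non-neighbour costs
  one unit of degree.\<close>

lemma deg_rest_le:
  assumes "v \<in> rest" "S \<subseteq> rest - {v}" "\<And>x. x \<in> S \<Longrightarrow> d v x \<noteq> 1"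
  shows "deg v + card S + 1 \<le> card (N v) + m"
proof -
  let ?Q = "{x \<in> rest. d v x = 1}"
  have fin: "finite S" using assms(2) finite_rest finite_subset by blast
  have "card (insert v (?Q \<union> S)) \<le> card rest"
    using assms finite_rest by (intro card_mono) auto
  moreover have "card (insert v (?Q \<union> S)) = card (?Q \<union> S) + 1"
    using assms fin finite_rest d_self[of v] rest_in[of v] by (subst card_insert_disjoint) auto
  moreover have "card (?Q \<union> S) = card ?Q + card S"
    using assms fin finite_rest by (intro card_Un_disjoint) auto
  ultimately show ?thesis using deg_rest[OF assms(1)] by (simp add: m_def)
qed

lemma deg_rest_eq_imp_clique:
  assumes "v \<in> rest" "deg v + 1 = card (N v) + m" "x \<in> rest" "x \<noteq> v"
  shows "d v x = 1"
proof (rule ccontr)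
  assume "d v x \<noteq> 1"
  then show False using deg_rest_le[of v "{x}"] assms by simp
qed

text \<open>The degree of \<open>u j\<close> splits into path edges and edges to
  \<open>rest\<close>; the latter are counted from their other end by exchanging two sums.\<close>

lemma xi_decomp: "xi = (\<Sum>j\<le>D. path_deg D j * ec (u j)) + (\<Sum>v\<in>rest. c v)"
proof -
  have "xi = (\<Sum>x\<in>u ` {..D}. deg x * ec x) + (\<Sum>v\<in>rest. deg v * ec v)"
    unfolding xi_def using finite_rest
    by (subst V_eq) (intro sum.union_disjoint, auto simp: rest_def)
  also have "(\<Sum>x\<in>u ` {..D}. deg x * ec x) = (\<Sum>j\<le>D. deg (u j) * ec (u j))"
    by (simp add: sum.reindex[OF inj_u])
  also have "\<dots> = (\<Sum>j\<le>D. path_deg D j * ec (u j) + (\<Sum>v | v \<in> rest \<and> d v (u j) = 1. ec (u j)))"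
    by (intro sum.cong) (simp_all add: deg_path algebra_simps)
  also have "\<dots> = (\<Sum>j\<le>D. path_deg D j * ec (u j))
      + (\<Sum>j\<le>D. \<Sum>v | v \<in> rest \<and> d v (u j) = 1. ec (u j))"
    by (simp add: sum.distrib)
  also have "(\<Sum>j\<le>D. \<Sum>v | v \<in> rest \<and> d v (u j) = 1. ec (u j))
      = (\<Sum>v\<in>rest. \<Sum>j | j \<in> {..D} \<and> d v (u j) = 1. ec (u j))"
    using finite_rest by (intro sum.swap_restrict) auto
  finally show ?thesis by (simp add: c_def sum.distrib N_def)
qed

lemma path_ecc_le_ec: "j \<le> D \<Longrightarrow> path_ecc D j \<le> ec (u j)"
  using d_le_ec[OF u_in, of 0 "u j"] d_le_ec[OF u_in, of D "u j"] d_u[of j 0] d_u[of j D]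
  by (auto simp: path_ecc_def)

lemma d_u_le_path_ecc: "\<lbrakk>i \<le> D; j \<le> D\<rbrakk> \<Longrightarrow> d (u j) (u i) \<le> path_ecc D j"
  using d_u by (auto simp: path_ecc_def)

lemma path_ecc_ge_2: "2 \<le> path_ecc D j"
  using D3 by (auto simp: path_ecc_def)

lemma d_rest_u_le:
  assumes "v \<in> rest" "i \<in> N v" "j \<le> D"
  shows "d v (u j) \<le> 1 + (i - j) + (j - i)"
  using d_triangle[of v "u i" "u j"] rest_in[OF assms(1)] u_in N_le[OF assms(2)] N_d[OF assms(2)]
    d_u[of i j] assms(3) by simp

text \<open>Two path neighbours of \<open>v\<close> are joined through \<open>v\<close> by a walk of
  length 2, while \<open>u\<close> is a geodesic.\<close>

lemma N_window:
  assumes "v \<in> rest" "i \<in> N v" "j \<in> N v"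
  shows "j \<le> i + 2"
  using d_triangle[of "u i" v "u j"] rest_in[OF assms(1)] u_in N_le[OF assms(2)] N_le[OF assms(3)]
    N_d[OF assms(2)] N_d[OF assms(3)] d_u[of i j] d_commute[of v "u i"] by simp

lemma N_window_cases:
  assumes "v \<in> rest"
  shows "card (N v) \<le> 3"
    and "card (N v) = 2 \<Longrightarrow> \<exists>a b. N v = {a, b} \<and> a < b \<and> b \<le> a + 2 \<and> b \<le> D"
    and "card (N v) = 3 \<Longrightarrow> \<exists>a. N v = {a, a + 1, a + 2} \<and> a + 2 \<le> D"
proof -
  let ?a = "Min (N v)"
  have sub: "N v \<subseteq> {?a, ?a + 1, ?a + 2}" if "N v \<noteq> {}"
  proof
    fix j assume j: "j \<in> N v"
    then have "?a \<le> j" "j \<le> ?a + 2"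
      using N_window[OF assms _ j] Min_in[OF finite_N that] finite_N by auto
    then show "j \<in> {?a, ?a + 1, ?a + 2}" by auto
  qed
  have card3: "card {?a, ?a + 1, ?a + 2} = 3" by simp
  show "card (N v) \<le> 3"
    using card_mono[OF _ sub] card3 by (cases "N v = {}") auto
  show "\<exists>a. N v = {a, a + 1, a + 2} \<and> a + 2 \<le> D" if c: "card (N v) = 3"
  proof -
    have "N v = {?a, ?a + 1, ?a + 2}"
      using sub c card3 by (intro card_subset_eq) auto
    then show ?thesis using N_le[of _ v] by blast
  qed
  show "\<exists>a b. N v = {a, b} \<and> a < b \<and> b \<le> a + 2 \<and> b \<le> D" if c: "card (N v) = 2"
  proof -
    obtain a b where ab: "N v = {a, b}" "a \<noteq> b" using c card_2_iff by metis
    define x y where "x = min a b" and "y = max a b"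
    then have "N v = {x, y}" "x < y" using ab by (auto simp: min_def max_def)
    then show ?thesis using N_window[OF assms, of x y] N_le[of y v]
      by (intro exI[of _ x] exI[of _ y]) simp
  qed
qed

end

section \<open>The upper bound\<close>

locale diametral = geodesic +
  assumes d_le_D: "\<lbrakk>x \<in> V; y \<in> V\<rbrakk> \<Longrightarrow> d x y \<le> D"
begin

lemma ec_le_D: "x \<in> V \<Longrightarrow> ec x \<le> D"
  using ec_attained d_le_D by metis

text \<open>Path vertices are at distance at most \<open>path_ecc D j\<close> from
  \<open>u j\<close>, so an excess eccentricity is realised off the path.\<close>

lemma far_vertex:
  assumes "j \<le> D" "path_ecc D j < ec (u j)"
  obtains w where "w \<in> rest" "d (u j) w = ec (u j)"
proof -
  obtain w where w: "w \<in> V" "d (u j) w = ec (u j)" using ec_attained u_in assms(1) by blast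
  from w(1) have "w \<in> rest"
  proof (cases rule: V_cases)
    case (path i)
    then show ?thesis using d_u_le_path_ecc[of i j] assms w by simp
  qed
  with w that show ?thesis by blast
qed

section \<open>Contribution of a single remaining vertex\<close>

definition tight :: "'a \<Rightarrow> bool" where
  "tight v \<longleftrightarrow> (\<forall>j\<in>N v. ec (u j) = path_ecc D j)"

text \<open>A path neighbour with excess eccentricity is far from some remaining vertex, which then is a
  non-neighbour of \<open>v\<close>.\<close>

lemma deg_not_tight:
  assumes v: "v \<in> rest" and "\<not> tight v"
  shows "deg v + 2 \<le> card (N v) + m"
proof -
  obtain j where j: "j \<in> N v" "path_ecc D j < ec (u j)"
    using assms(2) path_ecc_le_ec N_le unfolding tight_def by (metis le_neq_implies_less)
  then obtain w where w: "w \<in> rest" "d (u j) w = ec (u j)" using far_vertex N_le by metis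
  have "3 \<le> d (u j) w" using path_ecc_ge_2[of j] j w by simp
  moreover have "d (u j) w \<le> d (u j) v + d v w" "d (u j) v = 1"
    using d_triangle[of "u j" v w] d_commute[of "u j" v] N_d[OF j(1)] N_le[OF j(1)] u_in rest_in v w
    by auto
  ultimately have "2 \<le> d v w" by simp
  then have "w \<noteq> v" "d v w \<noteq> 1" using d_self rest_in[OF v] by auto
  then show ?thesis using deg_rest_le[OF v, of "{w}"] w by simp
qed

lemma deg_le: "v \<in> rest \<Longrightarrow> deg v + 1 \<le> card (N v) + m"
  using deg_rest_le[of v "{}"] by simp

lemma sum_ec_le: "(\<Sum>j\<in>N v. ec (u j)) \<le> card (N v) * D"
  using sum_bounded_above[of "N v" "\<lambda>j. ec (u j)" D] ec_le_D u_in N_le by simp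

text \<open>Every eccentricity is replaced by \<open>D\<close>; this crude estimate suffices when
  the degree is known to be small.\<close>

lemma c_le_trivial:
  assumes "v \<in> rest"
  shows "c v \<le> (card (N v) + deg v) * D"
proof -
  have "deg v * ec v \<le> deg v * D" using ec_le_D rest_in assms by simp
  then show ?thesis unfolding c_def add_mult_distrib using sum_ec_le by (intro add_mono)
qed

lemma path_ecc_eq_D: "j \<le> D \<Longrightarrow> path_ecc D j = D \<longleftrightarrow> j = 0 \<or> j = D"
  using D3 by (cases "j \<le> D - j") (auto simp: path_ecc_def max_def)

lemma path_ecc_eq_pred_D: "j \<le> D \<Longrightarrow> path_ecc D j = D - 1 \<longleftrightarrow> j = 1 \<or> j = D - 1"
  using D3 by (cases "j \<le> D - j") (auto simp: path_ecc_def max_def)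

text \<open>For tight \<open>v\<close> the two path eccentricities sum to at most
  \<open>D + (D - 1)\<close>, because positions at distance at most 2 are not both ends. Equality in
  the bound forces maximal degree and eccentricity as well.\<close>

lemma c_two_nbrs:
  assumes v: "v \<in> rest" and N2: "card (N v) = 2"
  shows "c v \<le> two_nbr_bound D m"
    and "c v = two_nbr_bound D m \<Longrightarrow>
      deg v + 1 = card (N v) + m \<and> ec v = D \<and> (N v = {0, 1} \<or> N v = {D - 1, D})"
proof -
  obtain a b where ab: "N v = {a, b}" "a < b" "b \<le> a + 2" "b \<le> D"
    using N_window_cases(2)[OF v N2] by blast
  have c: "c v = ec (u a) + ec (u b) + deg v * ec v" using ab by (simp add: c_def)
  \<comment> \<open>Relative to the bound, the missing neighbour loses \<open>D\<close>, while
    excess eccentricities on the path gain at most 1.\<close>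
  have less: "c v < two_nbr_bound D m" if "\<not> tight v"
  proof -
    have "deg v \<le> m" using deg_not_tight[OF v that] N2 by simp
    then have "(card (N v) + deg v) * D \<le> (2 + m) * D" using N2 by simp
    then have "c v \<le> (2 + m) * D" using c_le_trivial[OF v] by linarith
    then show ?thesis using D3 by (simp add: two_nbr_bound_def algebra_simps)
  qed
  have dv: "deg v \<le> m + 1" using deg_le[OF v] N2 by simp
  have ev: "ec v \<le> D" using ec_le_D rest_in v by blast
  have de: "deg v * ec v \<le> (m + 1) * D" using dv ev by (rule mult_le_mono)
  have pe: "path_ecc D a + path_ecc D b \<le> 2 * D - 1"
    using ab D3 by (auto simp: path_ecc_def max_def)
  show "c v \<le> two_nbr_bound D m"
  proof (cases "tight v")
    case True
    then show ?thesis using c ab pe de by (simp add: tight_def two_nbr_bound_def)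
  qed (use less in simp)
  assume eq: "c v = two_nbr_bound D m"
  then have t: "tight v" using less by auto
  then have pe': "path_ecc D a + path_ecc D b = 2 * D - 1" and dm: "deg v * ec v = (m + 1) * D"
    using c ab pe de eq by (simp_all add: tight_def two_nbr_bound_def)
  \<comment> \<open>For \<open>D = 3\<close> both inner path vertices have path eccentricity
    \<open>D - 1\<close>, so an end may also be paired with the farther of them.\<close>
  have ab': "a = 0 \<and> b = 1 \<or> a = D - 1 \<and> b = D \<or> D = 3 \<and> (a = 0 \<and> b = 2 \<or> a = 1 \<and> b = 3)"
  proof -
    have "path_ecc D a \<le> D" "path_ecc D b \<le> D" using ab(2-4) by (simp_all add: path_ecc_def)
    with pe' have "path_ecc D a = D \<and> path_ecc D b = D - 1 \<or> path_ecc D a = D - 1 \<and> path_ecc D b = D"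
      by linarith
    then have "(a = 0 \<or> a = D) \<and> (b = 1 \<or> b = D - 1) \<or> (a = 1 \<or> a = D - 1) \<and> (b = 0 \<or> b = D)"
      using path_ecc_eq_D[of a] path_ecc_eq_D[of b] path_ecc_eq_pred_D[of a] path_ecc_eq_pred_D[of b]
        ab(2-4) by simp
    then show ?thesis using ab(2-4) D3 by (elim disjE conjE) linarith+
  qed
  have dv': "deg v = m + 1" and ev': "ec v = D"
    using mult_eq_bounds[OF dv ev dm] D3 by simp_all
  \<comment> \<open>With such a gap in \<open>N v\<close> every path vertex is within distance 2 of
    \<open>v\<close>, and full degree makes all other remaining vertices adjacent to
    \<open>v\<close>, contradicting \<open>ec v = 3\<close>.\<close>
  have False if D: "D = 3" and h: "a = 0 \<and> b = 2 \<or> a = 1 \<and> b = 3"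
  proof -
    obtain w where w: "w \<in> V" "d v w = 3" using ec_attained[OF rest_in[OF v]] ev' D by auto
    from w(1) show False
    proof (cases rule: V_cases)
      case (path j)
      then show False
        using d_rest_u_le[OF v, of a j] d_rest_u_le[OF v, of b j] w(2) ab(1) h D by (elim disjE conjE) simp_all
    next
      case rest
      then show False using deg_rest_eq_imp_clique[OF v, of w] dv' N2 w d_self[of v] rest_in[OF v] by force
    qed
  qed
  then show "deg v + 1 = card (N v) + m \<and> ec v = D \<and> (N v = {0, 1} \<or> N v = {D - 1, D})"
    using ab' ab(1) dv' ev' N2 by (elim disjE conjE) simp_all
qed

text \<open>Otherwise \<open>v\<close> has at most one non-neighbour in \<open>rest\<close>, namely
  a vertex \<open>w\<close> at distance \<open>D\<close>, and \<open>w\<close> is reachable only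
  through the path end opposite the window \<open>N v\<close>. The other end would then be at
  distance \<open>D + 1\<close> from \<open>w\<close>.\<close>

lemma deg_three_nbrs_ec_D:
  assumes v: "v \<in> rest" and Nv: "N v = {a, a + 1, a + 2}" "a + 2 \<le> D" and ec: "ec v = D"
  shows "deg v \<le> m"
proof (rule ccontr)
  assume "\<not> deg v \<le> m"
  then have dv: "m + 1 \<le> deg v" by simp
  have cN: "card (N v) = 3" using Nv by simp
  \<comment> \<open>Distance \<open>D - 1\<close> from \<open>v\<close> to a path vertex occurs only
    if the window sits at one end and \<open>u j\<close> is the other end.\<close>
  have du: "d v (u j) \<le> D - 1 \<and> (D - 1 \<le> d v (u j) \<longrightarrow> j = D \<and> a = 0 \<or> j = 0 \<and> a + 2 = D)"
    if "j \<le> D" for j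
    using d_rest_u_le[OF v, of a j] d_rest_u_le[OF v, of "a + 1" j] d_rest_u_le[OF v, of "a + 2" j]
      that Nv D3 by auto
  obtain w where w: "w \<in> V" "d v w = D" using ec_attained[OF rest_in[OF v]] ec by auto
  from w(1) have wr: "w \<in> rest"
  proof (cases rule: V_cases)
    case (path j)
    then show ?thesis using du[of j] w D3 by auto
  qed
  have vw: "v \<noteq> w" using w d_self rest_in[OF v] D3 by auto
  have adj: "d v x = 1" if "x \<in> rest" "x \<noteq> v" "x \<noteq> w" for x
  proof (rule ccontr)
    assume "d v x \<noteq> 1"
    moreover have "d v w \<noteq> 1" using w D3 by simp
    ultimately have "deg v + card {x, w} + 1 \<le> card (N v) + m"
      using that wr vw by (intro deg_rest_le[OF v]) auto
    then show False using dv cN that by simp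
  qed
  \<comment> \<open>The first vertex \<open>z\<close> after \<open>w\<close> on a geodesic to
    \<open>y\<close> is at distance at least \<open>D - 1\<close> from \<open>v\<close>. Remaining
    vertices other than \<open>w\<close> are within distance 1 of \<open>v\<close>, so
    \<open>z\<close> is a path end.\<close>
  have step: "\<exists>j. (j = D \<and> a = 0 \<or> j = 0 \<and> a + 2 = D) \<and> d w y = Suc (d (u j) y)"
    if y: "y \<in> V" "y \<noteq> w" for y
  proof -
    obtain k where k: "d w y = Suc k"
      using y w(1) d_eq_0_iff[of w y] not0_implies_Suc by metis
    then obtain z where z: "z \<in> V" "d w z = 1" "d z y = k" using d_step w(1) y(1) by blast
    have vz: "D \<le> d v z + 1"
      using d_triangle[of v z w] d_commute[of z w] z w rest_in[OF v] by simp
    from z(1) show ?thesis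
    proof (cases rule: V_cases)
      case (path j)
      then show ?thesis using du[of j] vz z k by auto
    next
      case rest
      then show ?thesis using adj[of z] vz z w D3 d_self d_commute[of w v] rest_in[OF v] by force
    qed
  qed
  have "u i \<noteq> w" if "i \<le> D" for i using wr that by (auto simp: rest_def)
  then obtain i j where
      "i = D \<and> a = 0 \<or> i = 0 \<and> a + 2 = D" "d w (u 0) = Suc (d (u i) (u 0))"
      "j = D \<and> a = 0 \<or> j = 0 \<and> a + 2 = D" "d w (u D) = Suc (d (u j) (u D))"
    using step[of "u 0"] step[of "u D"] u_in by auto
  then show False
    using d_u[of i 0] d_u[of j D] d_le_D[OF w(1) u_in, of 0] d_le_D[OF w(1) u_in, of D] D3 by auto
qed

text \<open>The extra 1 in the first clause accounts for vertices of eccentricity \<open>D\<close>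
  with a path neighbour of excess eccentricity. Eccentricity \<open>D\<close> costs two units of
  degree; smaller eccentricity leads to \<open>three_nbr_bound\<close>.\<close>

lemma c_three_nbrs:
  assumes v: "v \<in> rest" and N3: "card (N v) = 3"
  shows "c v \<le> rest_bound D m + 1"
    and "tight v \<Longrightarrow> c v \<le> rest_bound D m"
    and "\<lbrakk>tight v; c v = rest_bound D m\<rbrakk> \<Longrightarrow> c v = three_nbr_bound D m \<and>
      deg v + 1 = card (N v) + m \<and> ec v = D - 1 \<and> (N v = {0, 1, 2} \<or> N v = {D - 2, D - 1, D})"
proof -
  obtain a where a: "N v = {a, a + 1, a + 2}" "a + 2 \<le> D"
    using N_window_cases(3)[OF v N3] by blast
  have c: "c v = ec (u a) + ec (u (a + 1)) + ec (u (a + 2)) + deg v * ec v"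
    using a by (simp add: c_def)
  have dv: "deg v \<le> m + 2" using deg_le[OF v] N3 by simp
  have ev: "ec v \<le> D" using ec_le_D rest_in v by blast
  let ?p = "path_ecc D a + path_ecc D (a + 1) + path_ecc D (a + 2)"
  have pe: "?p \<le> 2 * D - 1 + max 2 (D - 2)"
    and pe_eq: "?p = 2 * D - 1 + max 2 (D - 2) \<Longrightarrow> a = 0 \<or> a + 2 = D"
    using a D3 by (auto simp: path_ecc_def max_def split: if_splits)
  have t: "c v = ?p + deg v * ec v" if "tight v" using that c a by (simp add: tight_def)
  \<comment> \<open>\<open>(m + 3) * D\<close> is \<open>two_nbr_bound D m + 1\<close>; tightness
    lowers the path sum to at most \<open>3 * D - 2\<close>, which makes the comparison
    strict.\<close>
  have large: "c v \<le> two_nbr_bound D m + 1 \<and> (tight v \<longrightarrow> c v < two_nbr_bound D m)" if "ec v = D"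
  proof -
    have dm: "deg v \<le> m" using deg_three_nbrs_ec_D[OF v a that] .
    then have "(card (N v) + deg v) * D \<le> (3 + m) * D" using N3 by simp
    then have "c v \<le> (3 + m) * D" using c_le_trivial[OF v] by linarith
    moreover have "deg v * ec v \<le> m * D" using dm that by simp
    moreover have "?p \<le> 3 * D - 2" using pe D3 by auto
    ultimately show ?thesis using t D3 by (auto simp: two_nbr_bound_def algebra_simps)
  qed
  have small: "c v \<le> three_nbr_bound D m" if "ec v \<le> D - 1"
  proof (cases "tight v")
    case True
    have "deg v * ec v \<le> (m + 2) * (D - 1)" using dv that by (rule mult_le_mono)
    then show ?thesis using t[OF True] pe by (simp add: three_nbr_bound_def)
  next
    case False
    \<comment> \<open>The missing neighbour saves \<open>D - 1\<close>, and the path sum exceeds its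
      tight maximum by at most \<open>D + 1 - max 2 (D - 2)\<close>, which is no larger.\<close>
    have "deg v \<le> m + 1" using deg_not_tight[OF v False] N3 by simp
    then have "deg v * ec v \<le> (m + 1) * (D - 1)" using that by (rule mult_le_mono)
    then have "c v \<le> 3 * D + (m + 1) * (D - 1)" using sum_ec_le[of v] N3 by (simp add: c_def)
    moreover obtain E where "D = Suc E" using D3 by (cases D) auto
    ultimately show ?thesis using D3 by (auto simp: three_nbr_bound_def algebra_simps)
  qed
  have cases: "ec v = D \<or> ec v \<le> D - 1" using ev by linarith
  show "c v \<le> rest_bound D m + 1" "tight v \<Longrightarrow> c v \<le> rest_bound D m"
    using cases large small unfolding rest_bound_def by linarith+
  assume tv: "tight v" and eq: "c v = rest_bound D m"
  have ev': "ec v \<le> D - 1" using cases large tv eq unfolding rest_bound_def by linarith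
  then have eq': "c v = three_nbr_bound D m" using small eq unfolding rest_bound_def by linarith
  have de: "deg v * ec v \<le> (m + 2) * (D - 1)" using dv ev' by (rule mult_le_mono)
  then have "?p = 2 * D - 1 + max 2 (D - 2)" and dm: "deg v * ec v = (m + 2) * (D - 1)"
    using eq' pe t[OF tv] unfolding three_nbr_bound_def by linarith+
  moreover have "deg v = m + 2 \<and> ec v = D - 1"
    using mult_eq_bounds[OF dv ev' dm] D3 by auto
  moreover have "N v = {0, 1, 2} \<or> N v = {D - 2, D - 1, D}"
    using pe_eq[OF \<open>?p = _\<close>]
  proof
    assume "a = 0"
    then show ?thesis using a(1) by (simp add: numeral_2_eq_2)
  next
    assume "a + 2 = D"
    then have "D - 2 = a" "D - 1 = a + 1" by simp_all
    then show ?thesis using a(1) \<open>a + 2 = D\<close> by (intro disjI2) (simp only:)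
  qed
  ultimately show "c v = three_nbr_bound D m \<and> deg v + 1 = card (N v) + m \<and> ec v = D - 1 \<and>
      (N v = {0, 1, 2} \<or> N v = {D - 2, D - 1, D})"
    using N3 eq' by simp
qed

lemma c_few_nbrs:
  assumes v: "v \<in> rest" and N1: "card (N v) \<le> 1"
  shows "c v < two_nbr_bound D m"
proof -
  have "deg v \<le> m" using deg_le[OF v] N1 by simp
  then have "(card (N v) + deg v) * D \<le> (1 + m) * D" using N1 by (intro mult_le_mono1 add_mono)
  then have "c v \<le> (1 + m) * D" using c_le_trivial[OF v] by linarith
  then show ?thesis using D3 by (simp add: two_nbr_bound_def)
qed

lemma c_le_bound:
  assumes v: "v \<in> rest" and "card (N v) \<noteq> 3 \<or> tight v"
  shows "c v \<le> rest_bound D m"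
proof -
  consider "card (N v) \<le> 1" | "card (N v) = 2" | "card (N v) = 3"
    using N_window_cases(1)[OF v] by linarith
  then show ?thesis
    using c_few_nbrs[OF v] c_two_nbrs(1)[OF v] c_three_nbrs(2)[OF v] assms(2)
    by cases (auto simp: rest_bound_def)
qed

section \<open>Excess eccentricities on the path\<close>

lemma path_part_le:
  assumes "\<And>j. j \<le> D \<Longrightarrow> ec (u j) \<le> path_ecc D j + r"
  shows "(\<Sum>j\<le>D. path_deg D j * ec (u j)) \<le> path_index D + 2 * r * (D - 1)"
proof -
  have "path_deg D j * ec (u j) \<le> path_deg D j * path_ecc D j + (if j \<in> {1..<D} then 2 * r else 0)"
    if "j \<in> {..D}" for j
  proof (cases "j = 0 \<or> j = D")
    case True
    \<comment> \<open>The ends already have eccentricity \<open>D\<close>, so only the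
      \<open>D - 1\<close> inner vertices, of path degree 2, can have an excess.\<close>
    then have "ec (u j) \<le> path_ecc D j" using ec_le_D u_in that by (auto simp: path_ecc_def)
    then show ?thesis by (simp add: trans_le_add1)
  next
    case False
    then have "path_deg D j = 2" "j \<in> {1..<D}" using that by (auto simp: path_deg_def)
    then show ?thesis using assms[of j] by auto
  qed
  then have "(\<Sum>j\<le>D. path_deg D j * ec (u j))
      \<le> (\<Sum>j\<le>D. path_deg D j * path_ecc D j + (if j \<in> {1..<D} then 2 * r else 0))"
    by (rule sum_mono)
  also have "\<dots> = path_index D + (\<Sum>j\<le>D. if j \<in> {1..<D} then 2 * r else 0)"
    by (simp add: sum.distrib path_index_def)
  also have "(\<Sum>j\<le>D. if j \<in> {1..<D} then 2 * r else 0) = (\<Sum>j\<in>{..D} \<inter> {1..<D}. 2 * r)"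
    by (rule sum.inter_restrict[symmetric]) simp
  also have "{..D} \<inter> {1..<D} = {1..<D}" by auto
  finally show ?thesis by (simp add: mult.commute)
qed

lemma excess_imp_less:
  assumes "\<exists>j\<le>D. path_ecc D j < ec (u j)"
  shows "xi < path_index D + m * rest_bound D m"
proof -
  define ex where "ex j = ec (u j) - path_ecc D j" for j
  define r where "r = Max (ex ` {..D})"
  let ?M = "rest_bound D m"
  have ex_le: "ex j \<le> r" if "j \<le> D" for j unfolding r_def using that by auto
  have "r \<in> ex ` {..D}" unfolding r_def by (intro Max_in) auto
  then obtain j where j: "j \<le> D" "ex j = r" by auto
  obtain j' where "j' \<le> D" "path_ecc D j' < ec (u j')" using assms by blast
  then have r1: "1 \<le> r" using ex_le[of j'] by (simp add: ex_def)
  have ecj: "ec (u j) = path_ecc D j + r" using j r1 by (simp add: ex_def)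
  then obtain w where w: "w \<in> rest" "d (u j) w = path_ecc D j + r"
    using far_vertex[OF j(1)] r1 by auto
  have wV: "w \<in> V" using w rest_in by blast
  have dwj: "d w (u j) = path_ecc D j + r" using d_commute[OF wV u_in[OF j(1)]] w(2) by simp
  have path: "(\<Sum>i\<le>D. path_deg D i * ec (u i)) \<le> path_index D + 2 * r * (D - 1)"
    using ex_le by (intro path_part_le) (simp add: ex_def le_diff_conv add.commute)
  \<comment> \<open>Only vertices with three path neighbours can exceed the bound; they are not adjacent to \<open>w\<close>, so
    their excess is charged to the degree of \<open>w\<close>.\<close>
  define F where "F = {v \<in> rest - {w}. d w v \<noteq> 1}"
  have finF: "finite F" using finite_rest by (simp add: F_def)
  have degw: "deg w + card F + 1 \<le> card (N w) + m"
    by (rule deg_rest_le[OF w(1)]) (auto simp: F_def)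
  have three_F: "v \<in> F" if v: "v \<in> rest" and N3: "card (N v) = 3" for v
  proof -
    obtain a where a: "N v = {a, a + 1, a + 2}" "a + 2 \<le> D"
      using N_window_cases(3)[OF v N3] by blast
    \<comment> \<open>A window of three consecutive path vertices comes within
      \<open>path_ecc D j - 2\<close> of \<open>u j\<close>.\<close>
    have "d v (u j) < path_ecc D j"
      using d_rest_u_le[OF v, of a j] d_rest_u_le[OF v, of "a + 1" j] d_rest_u_le[OF v, of "a + 2" j]
        a j(1) D3 by (auto simp: path_ecc_def max_def)
    moreover have "d w (u j) \<le> d w v + d v (u j)"
      using d_triangle wV rest_in[OF v] u_in[OF j(1)] by blast
    ultimately have "2 \<le> d w v" using dwj r1 by linarith
    then have "d w v \<noteq> 1" "v \<noteq> w" using d_self[OF wV] by auto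
    then show ?thesis using v by (simp add: F_def)
  qed
  \<comment> \<open>The possible overshoot of 1 is rounded up to \<open>D\<close>, so that its total
    over \<open>F\<close> joins \<open>deg w * D\<close> in the single product
    \<open>(deg w + card F) * D\<close>.\<close>
  have c_le: "c v \<le> ?M + (if v \<in> F then D else 0)" if v: "v \<in> rest" for v
    using c_le_bound[OF v] c_three_nbrs(1)[OF v] three_F[OF v] D3 by (cases "card (N v) = 3") auto
  \<comment> \<open>Accounting scheme for both cases below: \<open>Z\<close> collects vertices of
    contribution at most \<open>K\<close>, \<open>w\<close> also pays for the overshoot on
    \<open>F\<close>, and the total saving on \<open>Z\<close> against \<open>?M\<close> has to
    exceed the gain on the path.\<close>
  have *: "xi < path_index D + m * ?M"
    if Z: "Z \<subseteq> rest" "w \<in> Z" and K: "c w + card F * D \<le> K" "\<And>v. v \<in> Z - {w} \<Longrightarrow> c v \<le> K"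
      and small: "2 * r * (D - 1) + card Z * K < card Z * ?M" for Z K
  proof -
    have finZ: "finite Z" using Z finite_rest finite_subset by blast
    have cZ: "card Z \<le> m" unfolding m_def using Z finite_rest by (intro card_mono)
    have "(\<Sum>v\<in>rest - Z. c v) \<le> (\<Sum>v\<in>rest - Z. ?M + (if v \<in> F then D else 0))"
      using c_le by (intro sum_mono) auto
    also have "\<dots> = card (rest - Z) * ?M + (\<Sum>v\<in>rest - Z. if v \<in> F then D else 0)"
      by (simp add: sum.distrib)
    also have "(\<Sum>v\<in>rest - Z. if v \<in> F then D else 0) \<le> (\<Sum>v\<in>rest. if v \<in> F then D else 0)"
      using finite_rest by (intro sum_mono2) auto
    also have "\<dots> = card F * D"
    proof -
      have "(\<Sum>v\<in>rest. if v \<in> F then D else 0) = (\<Sum>v\<in>rest \<inter> F. D)"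
        by (rule sum.inter_restrict[symmetric]) (rule finite_rest)
      moreover have "rest \<inter> F = F" by (auto simp: F_def)
      ultimately show ?thesis by simp
    qed
    also have "card (rest - Z) = m - card Z"
      using Z finZ by (simp add: m_def card_Diff_subset)
    finally have out: "(\<Sum>v\<in>rest - Z. c v) \<le> (m - card Z) * ?M + card F * D" by simp
    have "(\<Sum>v\<in>Z. c v) = c w + (\<Sum>v\<in>Z - {w}. c v)" using Z finZ by (simp add: sum.remove)
    moreover have "(\<Sum>v\<in>Z - {w}. c v) \<le> card (Z - {w}) * K"
      using K(2) sum_bounded_above[of "Z - {w}" c K] by simp
    moreover have "card Z * K = K + card (Z - {w}) * K"
      using Z finZ card_Suc_Diff1[of Z w] by (metis mult_Suc)
    ultimately have inn: "(\<Sum>v\<in>Z. c v) + card F * D \<le> card Z * K" using K(1) by linarith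
    have "(\<Sum>v\<in>rest. c v) = (\<Sum>v\<in>rest - Z. c v) + (\<Sum>v\<in>Z. c v)"
      using Z finite_rest by (simp add: sum.subset_diff)
    moreover have "m * ?M = (m - card Z) * ?M + card Z * ?M"
      using cZ by (simp flip: add_mult_distrib)
    ultimately show ?thesis using xi_decomp path out inn small by linarith
  qed
  have M_ge: "(m + 3) * D - 1 \<le> ?M"
    using D3 by (auto simp: rest_bound_def two_nbr_bound_def algebra_simps)
  obtain E where E: "D = Suc E" using D3 by (cases D) auto
  show ?thesis
  proof (cases "r = 1")
    case True
    \<comment> \<open>\<open>w\<close> is at distance \<open>path_ecc D j + 1\<close> from
      \<open>u j\<close>, so a path neighbour of \<open>w\<close> is at least
      \<open>path_ecc D j\<close> away from \<open>u j\<close> and hence an end.\<close>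
    have N0: "i = 0 \<or> i = D" if "i \<in> N w" for i
      using d_rest_u_le[OF w(1) that j(1)] dwj True N_le[OF that] j(1)
      by (auto simp: path_ecc_def max_def split: if_splits)
    have "N w \<subseteq> {0} \<or> N w \<subseteq> {D}"
      using N0 N_window[OF w(1), of 0 D] D3 by auto
    then have N1: "card (N w) \<le> 1" using card_mono[of "{_}" "N w"] by auto
    have "c w + card F * D \<le> (card (N w) + deg w + card F) * D"
      using c_le_trivial[OF w(1)] by (simp add: add_mult_distrib)
    also have "\<dots> \<le> (m + 1) * D" using degw N1 by (intro mult_le_mono1) linarith
    finally have "c w + card F * D \<le> (m + 1) * D" .
    \<comment> \<open>The margin is tight: for \<open>r = 1\<close> the left side is
      \<open>(m + 3) * D - 2\<close>.\<close>
    moreover have "2 * r * (D - 1) + (m + 1) * D < ?M"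
      using M_ge True E by (simp add: algebra_simps)
    ultimately show ?thesis using w(1) by (intro *[of "{w}" "(m + 1) * D"]) auto
  next
    case False
    \<comment> \<open>The vertices at distance 0 to \<open>r - 2\<close> from \<open>w\<close> on a
      geodesic to \<open>u j\<close> are at least \<open>path_ecc D j + 2\<close> away from
      \<open>u j\<close>, too far for a path vertex or a neighbour of one.\<close>
    have "\<exists>z\<in>V. d w z = s \<and> d z (u j) = path_ecc D j + r - s" if "s < r - 1" for s
      using geodesic_vertex[OF wV u_in[OF j(1)], of s] dwj that by simp
    then obtain z where z: "\<And>s. s < r - 1 \<Longrightarrow> z s \<in> V \<and> d w (z s) = s \<and>
        d (z s) (u j) = path_ecc D j + r - s"
      by metis
    have zr: "z s \<in> rest" and zN: "N (z s) = {}" if s: "s < r - 1" for s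
    proof -
      have zV: "z s \<in> V" using z s by blast
      then show zr: "z s \<in> rest"
      proof (cases rule: V_cases)
        case (path i)
        then show ?thesis using z[OF s] d_u_le_path_ecc[of i j] d_commute[of "u i" "u j"] u_in j(1) s by simp
      qed
      show "N (z s) = {}"
      proof (rule ccontr)
        assume "N (z s) \<noteq> {}"
        then obtain i where i: "i \<in> N (z s)" by blast
        then have "d (z s) (u j) \<le> 1 + d (u i) (u j)"
          using d_triangle[OF zV u_in u_in, of i j] N_le N_d j(1) by metis
        also have "d (u i) (u j) \<le> path_ecc D j"
          using d_u_le_path_ecc[of i j] d_commute[of "u i" "u j"] u_in N_le[OF i] j(1) by simp
        finally show False using z[OF s] s by simp
      qed
    qed
    have inj: "inj_on z {..<r - 1}" using z by (metis inj_onI lessThan_iff)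
    have z0: "z 0 = w" using z[of 0] d_eq_0_iff[OF wV] False r1 by auto
    let ?Z = "z ` {..<r - 1}"
    have cardZ: "card ?Z = r - 1" using card_image[OF inj] by simp
    have wZ: "w \<in> ?Z" using z0 False r1 by (metis imageI le_neq_implies_less lessThan_iff zero_less_diff)
    have "card (N w) = 0" using zN[of 0] z0 False r1 by simp
    then have "c w + card F * D \<le> (deg w + card F) * D"
      using c_le_trivial[OF w(1)] by (simp add: add_mult_distrib)
    also have "\<dots> \<le> (m - 1) * D"
      using degw \<open>card (N w) = 0\<close> by (intro mult_le_mono1) linarith
    finally have Kw: "c w + card F * D \<le> (m - 1) * D" .
    have Kz: "c v \<le> (m - 1) * D" if v: "v \<in> ?Z" for v
    proof -
      have vr: "v \<in> rest" and "card (N v) = 0" using v zr zN by auto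
      moreover then have "deg v * D \<le> (m - 1) * D" using deg_le[OF vr] by (intro mult_le_mono1) simp
      ultimately show ?thesis using c_le_trivial[OF vr] by (metis add_0 order_trans)
    qed
    have m1: "1 \<le> m" using degw \<open>card (N w) = 0\<close> by simp
    \<comment> \<open>Each vertex of \<open>?Z\<close> saves at least \<open>4 * D - 1\<close>, and
      \<open>2 * r\<close> is at most \<open>4 * (r - 1)\<close> because \<open>r\<close> is at
      least 2.\<close>
    have "2 * r * (D - 1) + (r - 1) * ((m - 1) * D) < (r - 1) * ?M"
    proof -
      obtain t where t: "r = t + 2" using False r1 by (metis One_nat_def Suc_1 add.commute le_Suc_ex le_antisym not_less_eq_eq)
      obtain l where l: "m = l + 1" using m1 by (metis add.commute le_Suc_ex)
      have "2 * r * (D - 1) + (r - 1) * ((m - 1) * D) < (r - 1) * ((m + 3) * D - 1)"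
        using t l E by (simp add: algebra_simps)
      also have "\<dots> \<le> (r - 1) * ?M" using M_ge by (rule mult_le_mono2)
      finally show ?thesis .
    qed
    then show ?thesis using Kw Kz zr wZ cardZ by (intro *[of ?Z "(m - 1) * D"]) auto
  qed
qed

section \<open>The bound and its equality case\<close>

theorem xi_le: "xi \<le> path_index D + m * rest_bound D m"
proof (cases "\<exists>j\<le>D. path_ecc D j < ec (u j)")
  case False
  then have "(\<Sum>j\<le>D. path_deg D j * ec (u j)) \<le> path_index D"
    using path_part_le[of 0] by (simp add: not_less)
  moreover have "(\<Sum>v\<in>rest. c v) \<le> m * rest_bound D m"
  proof -
    have "tight v" for v
      using False path_ecc_le_ec N_le unfolding tight_def by (meson le_antisym not_less)
    then show ?thesis using sum_bounded_above[of rest c "rest_bound D m"] c_le_bound by (simp add: m_def)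
  qed
  ultimately show ?thesis using xi_decomp by linarith
qed (use excess_imp_less in fastforce)

text \<open>Equality rules out any excess, so every remaining vertex is tight and attains its
  individual maximum; full degree then makes \<open>rest\<close> a clique. The clause
  \<open>ec v = D\<close> later excludes vertices with two path neighbours when both ends are
  occupied.\<close>

theorem xi_eq_imp:
  assumes "xi = path_index D + m * rest_bound D m" and v: "v \<in> rest"
  shows "(\<forall>x\<in>rest - {v}. d v x = 1) \<and>
    (rest_bound D m = two_nbr_bound D m \<and> ec v = D \<and> (N v = {0, 1} \<or> N v = {D - 1, D}) \<or>
     rest_bound D m = three_nbr_bound D m \<and> (N v = {0, 1, 2} \<or> N v = {D - 2, D - 1, D}))"
proof -
  have no: "\<not> (\<exists>j\<le>D. path_ecc D j < ec (u j))" using excess_imp_less assms by auto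
  then have path: "(\<Sum>j\<le>D. path_deg D j * ec (u j)) \<le> path_index D"
    using path_part_le[of 0] by (simp add: not_less)
  have tight: "tight x" for x
    using no path_ecc_le_ec N_le unfolding tight_def by (meson le_antisym not_less)
  have "c v = rest_bound D m"
  proof (rule ccontr)
    assume "c v \<noteq> rest_bound D m"
    then have "c v < rest_bound D m" using c_le_bound[OF v] tight by fastforce
    then have "(\<Sum>x\<in>rest. c x) < (\<Sum>x\<in>rest. rest_bound D m)"
      using v c_le_bound tight finite_rest by (intro sum_strict_mono_ex1) auto
    then show False using path assms(1) xi_decomp by (simp add: m_def)
  qed
  consider "card (N v) \<le> 1" | "card (N v) = 2" | "card (N v) = 3"
    using N_window_cases(1)[OF v] by linarith
  then show ?thesis
  proof cases
    case 1
    then show ?thesis using c_few_nbrs[OF v] \<open>c v = rest_bound D m\<close> by (simp add: rest_bound_def)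
  next
    case 2
    then have "c v = two_nbr_bound D m"
      using c_two_nbrs(1)[OF v] \<open>c v = rest_bound D m\<close> by (simp add: rest_bound_def)
    then show ?thesis
      using c_two_nbrs(2)[OF v 2] deg_rest_eq_imp_clique[OF v] \<open>c v = rest_bound D m\<close> by auto
  next
    case 3
    then show ?thesis
      using c_three_nbrs(3)[OF v 3 tight] deg_rest_eq_imp_clique[OF v] \<open>c v = rest_bound D m\<close> by auto
  qed
qed

end

section \<open>Existence of geodesics\<close>

context graph_metric
begin

lemma exists_geodesic:
  assumes "x \<in> V" "y \<in> V"
  shows "\<exists>u. u 0 = x \<and> u (d x y) = y \<and> (\<forall>j\<le>d x y. u j \<in> V) \<and>
    (\<forall>i j. i \<le> j \<longrightarrow> j \<le> d x y \<longrightarrow> d (u i) (u j) = j - i)"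
  using assms(1)
proof (induction "d x y" arbitrary: x)
  case 0
  then show ?case
    using assms(2) d_eq_0_iff[of x y] d_self[of y] by (intro exI[of _ "\<lambda>_. x"]) auto
next
  case (Suc k)
  then obtain z where z: "z \<in> V" "d x z = 1" "d z y = k"
    using d_step assms(2) by metis
  then obtain u where u: "u 0 = z" "u k = y" "\<And>j. j \<le> k \<Longrightarrow> u j \<in> V"
      "\<And>i j. i \<le> j \<Longrightarrow> j \<le> k \<Longrightarrow> d (u i) (u j) = j - i"
    using Suc.hyps(1)[of z] by auto
  \<comment> \<open>Going through \<open>z\<close> gives the upper bound, and the distance
    \<open>Suc k\<close> from \<open>x\<close> to \<open>y\<close> past \<open>u j\<close> gives the
    lower one.\<close>
  have x: "d x (u j) = Suc j" if "j \<le> k" for j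
    using d_triangle[of x z "u j"] d_triangle[of x "u j" y] u(1,2) u(3)[OF that] u(4)[of 0 j]
      u(4)[of j k] that z Suc.hyps(2) Suc.prems assms(2) by simp
  show ?case
    unfolding Suc.hyps(2)[symmetric]
  proof (intro exI[of _ "case_nat x u"] conjI allI impI)
    fix i j assume "i \<le> j" "j \<le> Suc k"
    then show "d (case_nat x u i) (case_nat x u j) = j - i"
      using x u(4) d_self Suc.prems by (cases i; cases j) auto
  next
    fix j assume "j \<le> Suc k"
    then show "case_nat x u j \<in> V" using u(3) Suc.prems by (cases j) auto
  qed (use u in auto)
qed

end

section \<open>Graphs presented as a path with an attached clique\<close>

lemma (in pair_graph) gdist_le: "awalk x p y \<Longrightarrow> gdist G x y \<le> length p"
  unfolding gdist_def by (intro Least_le) blast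

text \<open>A connected symmetric digraph is strongly connected, so the minimum in
  \<open>gdist\<close> ranges over a nonempty set and is attained.\<close>

lemma (in pair_graph) gdist_awalk:
  assumes "connected G" "x \<in> pverts G" "y \<in> pverts G"
  obtains p where "awalk x p y" "length p = gdist G x y"
proof -
  have "strongly_connected G" using symmetric_connected_imp_strongly_connected[OF sym_arcs assms(1)] .
  then obtain p where "awalk x p y"
    using assms(2,3) unfolding strongly_connected_def reachable_awalk with_proj_simps by blast
  then have "\<exists>k p. awalk x p y \<and> length p = k" by blast
  from LeastI_ex[OF this] that show ?thesis unfolding gdist_def by blast
qed

text \<open>Walks are reversed for symmetry and concatenated for the triangle inequality; removing
  the first arc of a shortest walk gives \<open>d_step\<close>.\<close>

lemma (in pair_graph) graph_metric_gdist:
  assumes conn: "connected G"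
  shows "graph_metric (pverts G) (gdist G)"
proof
  show "finite (pverts G)" by (rule pair_finite_verts)
next
  fix x y assume xy: "x \<in> pverts G" "y \<in> pverts G"
  show "gdist G x y = 0 \<longleftrightarrow> x = y"
  proof
    assume "gdist G x y = 0"
    then show "x = y" using gdist_awalk[OF conn xy] by (auto simp: awalk_Nil_iff)
  next
    assume "x = y"
    then show "gdist G x y = 0" using gdist_le[of x "[]" y] xy by (simp add: awalk_Nil_iff)
  qed
  have "gdist G b a \<le> gdist G a b" if "a \<in> pverts G" "b \<in> pverts G" for a b
  proof -
    obtain p where "awalk a p b" "length p = gdist G a b" using gdist_awalk[OF conn \<open>a \<in> _\<close> \<open>b \<in> _\<close>] .
    moreover have "length (rev_path p) = length p" by (induction p) auto
    ultimately show ?thesis using gdist_le[of b "rev_path p" a] by simp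
  qed
  then show "gdist G x y = gdist G y x" using xy by (simp add: antisym)
next
  fix x y z assume "x \<in> pverts G" "y \<in> pverts G" "z \<in> pverts G"
  then obtain p q where "awalk x p y" "length p = gdist G x y" "awalk y q z" "length q = gdist G y z"
    using gdist_awalk[OF conn] by metis
  then show "gdist G x z \<le> gdist G x y + gdist G y z" using gdist_le[OF awalk_appendI, of x p y q z] by simp
next
  fix x y k assume xy: "x \<in> pverts G" "y \<in> pverts G" "gdist G x y = Suc k"
  obtain p where p: "awalk x p y" "length p = Suc k" using gdist_awalk[OF conn xy(1,2)] xy(3) by metis
  then obtain e q where e: "p = e # q" by (cases p) auto
  then have *: "e \<in> parcs G" "fst e = x" "awalk (snd e) q y" using p by (auto simp: awalk_Cons_iff)
  then have z: "snd e \<in> pverts G" by (simp add: arc_snd_in_verts)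
  have 1: "gdist G (snd e) y \<le> k" using gdist_le[OF *(3)] p e by simp
  have "awalk x [e] (snd e)" using * z by (auto simp: awalk_simps)
  then have 2: "gdist G x (snd e) \<le> 1" using gdist_le[of x "[e]" "snd e"] by simp
  obtain p' q' where "awalk x p' (snd e)" "length p' = gdist G x (snd e)"
      "awalk (snd e) q' y" "length q' = gdist G (snd e) y"
    using gdist_awalk[OF conn] xy z by metis
  then have "Suc k \<le> gdist G x (snd e) + gdist G (snd e) y"
    using gdist_le[OF awalk_appendI, of x p' "snd e" q' y] xy(3) by simp
  with 1 2 have "gdist G x (snd e) = 1 \<and> gdist G (snd e) y = k" by linarith
  then show "\<exists>z\<in>pverts G. gdist G x z = 1 \<and> gdist G z y = k" using z by blast
qed

lemma (in pair_graph) gdist_eq_1_iff: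
  assumes conn: "connected G" and xy: "x \<in> pverts G" "y \<in> pverts G"
  shows "gdist G x y = 1 \<longleftrightarrow> (x, y) \<in> parcs G"
proof
  assume "gdist G x y = 1"
  then obtain p where "awalk x p y" "length p = 1" using gdist_awalk[OF conn xy] by metis
  then show "(x, y) \<in> parcs G" by (auto simp: length_Suc_conv awalk_simps)
next
  interpret graph_metric "pverts G" "gdist G" using graph_metric_gdist[OF conn] .
  assume a: "(x, y) \<in> parcs G"
  then have "awalk x [(x, y)] y" using xy by (auto simp: awalk_simps)
  then have "gdist G x y \<le> 1" using gdist_le[of x "[(x, y)]" y] by simp
  moreover have "gdist G x y \<noteq> 0" using d_eq_0_iff[OF xy] no_loops'[OF a] by simp
  ultimately show "gdist G x y = 1" by linarith
qed

lemma (in pair_graph) ecc_conn_index_eq_xi: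
  assumes conn: "connected G"
  shows "ecc_conn_index G = graph_metric.xi (pverts G) (gdist G)"
proof -
  interpret graph_metric "pverts G" "gdist G" using graph_metric_gdist[OF conn] .
  have "out_degree G x = deg x" if x: "x \<in> pverts G" for x
  proof -
    have "out_arcs G x = Pair x ` nbrs x"
    proof (intro set_eqI iffI)
      fix e assume "e \<in> out_arcs G x"
      then obtain y where y: "e = (x, y)" "(x, y) \<in> parcs G" by (cases e) auto
      then have "y \<in> nbrs x" using gdist_eq_1_iff[OF conn x] in_arcsD2[of x y] by (simp add: nbrs_def)
      then show "e \<in> Pair x ` nbrs x" using y by simp
    next
      fix e assume "e \<in> Pair x ` nbrs x"
      then show "e \<in> out_arcs G x" using gdist_eq_1_iff[OF conn x] by (auto simp: nbrs_def)
    qed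
    then show ?thesis by (simp add: out_degree_def deg_def card_image inj_on_def)
  qed
  then show ?thesis by (simp add: ecc_conn_index_def xi_def ec_def ecc_def)
qed

section \<open>Isomorphisms of pair graphs\<close>

lemma digraph_iso_iff:
  assumes G: "pair_wf_digraph G" and H: "pair_wf_digraph H"
  shows "digraph_iso (with_proj G) (with_proj H) \<longleftrightarrow>
    (\<exists>f. bij_betw f (pverts G) (pverts H) \<and>
      (\<forall>x\<in>pverts G. \<forall>y\<in>pverts G. (x, y) \<in> parcs G \<longleftrightarrow> (f x, f y) \<in> parcs H))"
    (is "?L \<longleftrightarrow> ?R")
proof
  interpret G: pair_wf_digraph G by (rule G)
  assume ?L
  then obtain h where h: "pre_digraph.digraph_isomorphism (with_proj G) h"
      "with_proj H = app_iso h (with_proj G)"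
    unfolding digraph_iso_def by blast
  let ?f = "iso_verts h"
  have inj: "inj_on ?f (pverts G)" using h(1) by (auto simp: pre_digraph.digraph_isomorphism_def)
  have V: "pverts H = ?f ` pverts G" and A: "parcs H = iso_arcs h ` parcs G"
    and tl: "iso_tail h = fst" and hd: "iso_head h = snd"
    using h(2) by (auto simp: with_proj_def app_iso_def)
  \<comment> \<open>Heads and tails on both sides are the projections, so the arc map is determined
    by the vertex map.\<close>
  have arc: "iso_arcs h (x, y) = (?f x, ?f y)" if "(x, y) \<in> parcs G" for x y
    using h(1) that tl hd by (auto simp: pre_digraph.digraph_isomorphism_def prod_eq_iff)
  have "(x, y) \<in> parcs G" if xy: "x \<in> pverts G" "y \<in> pverts G" "(?f x, ?f y) \<in> parcs H" for x y
  proof -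
    obtain e where e: "e \<in> parcs G" "(?f x, ?f y) = iso_arcs h e" using xy(3) A by auto
    obtain x' y' where "e = (x', y')" by (cases e)
    with e have a: "(x', y') \<in> parcs G" and "?f x = ?f x'" "?f y = ?f y'" using arc[of x' y'] by auto
    moreover have "x' \<in> pverts G" "y' \<in> pverts G" using G.wellformed'[OF a] by blast+
    ultimately show ?thesis using inj_onD[OF inj] xy(1,2) by blast
  qed
  moreover have "(?f x, ?f y) \<in> parcs H" if "(x, y) \<in> parcs G" for x y
    using A arc[OF that] that by force
  ultimately show ?R using inj V by (intro exI[of _ ?f]) (auto simp: bij_betw_def)
next
  interpret G: pair_wf_digraph G by (rule G)
  interpret H: pair_wf_digraph H by (rule H)
  assume ?R
  then obtain f where f: "inj_on f (pverts G)" "f ` pverts G = pverts H"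
      "\<And>x y. x \<in> pverts G \<Longrightarrow> y \<in> pverts G \<Longrightarrow> (x, y) \<in> parcs G \<longleftrightarrow> (f x, f y) \<in> parcs H"
    by (auto simp: bij_betw_def)
  define h where "h = \<lparr> iso_verts = f, iso_arcs = map_prod f f, iso_head = snd, iso_tail = fst \<rparr>"
  have "inj_on (map_prod f f) (parcs G)"
    using f(1) G.wellformed' by (auto simp: inj_on_def)
  then have "pre_digraph.digraph_isomorphism (with_proj G) h"
    unfolding pre_digraph.digraph_isomorphism_def h_def using f(1) G.wf_digraph by auto
  moreover have "map_prod f f ` parcs G = parcs H"
  proof (intro set_eqI iffI)
    fix e assume e: "e \<in> parcs H"
    then obtain x y where xy: "x \<in> pverts G" "y \<in> pverts G" "e = (f x, f y)"
      using f(2) H.arc_fst_in_verts H.arc_snd_in_verts by (metis imageE prod.collapse)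
    then have "(x, y) \<in> parcs G" using f(3) e by simp
    then show "e \<in> map_prod f f ` parcs G" using xy(3) by (intro image_eqI[of _ _ "(x, y)"]) simp_all
  next
    fix e assume "e \<in> map_prod f f ` parcs G"
    then obtain x y where "(x, y) \<in> parcs G" "e = (f x, f y)" by auto
    then show "e \<in> parcs H" using f(3) G.wellformed' by blast
  qed
  then have "with_proj H = app_iso h (with_proj G)"
    using f(2) by (simp add: h_def with_proj_def app_iso_def)
  ultimately show ?L unfolding digraph_iso_def by blast
qed

text \<open>\<open>G\<close> consists of the induced path \<open>u\<close> and the clique \<open>Q\<close>; \<open>N v\<close> holds the indices of the path
  neighbours of \<open>v \<in> Q\<close>.\<close>

definition path_clique :: "'a pair_pre_digraph \<Rightarrow> nat \<Rightarrow> (nat \<Rightarrow> 'a) \<Rightarrow> 'a set \<Rightarrow> ('a \<Rightarrow> nat set) \<Rightarrow> bool" where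
  "path_clique G D u Q N \<longleftrightarrow>
    inj_on u {..D} \<and> pverts G = u ` {..D} \<union> Q \<and> u ` {..D} \<inter> Q = {} \<and>
    (\<forall>i\<le>D. \<forall>j\<le>D. (u i, u j) \<in> parcs G \<longleftrightarrow> i = Suc j \<or> j = Suc i) \<and>
    (\<forall>v\<in>Q. N v \<subseteq> {..D} \<and>
      (\<forall>j\<le>D. ((v, u j) \<in> parcs G \<longleftrightarrow> j \<in> N v) \<and> ((u j, v) \<in> parcs G \<longleftrightarrow> j \<in> N v)) \<and>
      (\<forall>w\<in>Q. (v, w) \<in> parcs G \<longleftrightarrow> v \<noteq> w))"

text \<open>Carries the shape back along the isomorphism together with its neighbour sets, so that
  the index of \<open>G\<close> can be computed from the shape of \<open>H\<close>.\<close>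

lemma path_clique_transport:
  assumes G: "pair_wf_digraph G" and H: "pair_wf_digraph H"
    and iso: "digraph_iso (with_proj G) (with_proj H)" and pc: "path_clique H D u Q N"
  shows "\<exists>f u' N'. bij_betw f Q (f ` Q) \<and> path_clique G D u' (f ` Q) N' \<and> (\<forall>v\<in>Q. N' (f v) = N v)"
proof -
  obtain h where h: "bij_betw h (pverts G) (pverts H)"
      "\<And>x y. x \<in> pverts G \<Longrightarrow> y \<in> pverts G \<Longrightarrow> (x, y) \<in> parcs G \<longleftrightarrow> (h x, h y) \<in> parcs H"
    using iso unfolding digraph_iso_iff[OF G H] by blast
  define f where "f = inv_into (pverts G) h"
  have bij: "bij_betw f (pverts H) (pverts G)" unfolding f_def by (rule bij_betw_inv_into[OF h(1)])
  have V: "pverts H = u ` {..D} \<union> Q" using pc by (simp add: path_clique_def)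
  have inH: "u i \<in> pverts H" if "i \<le> D" for i using that V by auto
  have QH: "v \<in> pverts H" if "v \<in> Q" for v using that V by auto
  have arc: "(f x, f y) \<in> parcs G \<longleftrightarrow> (x, y) \<in> parcs H" if "x \<in> pverts H" "y \<in> pverts H" for x y
    using h(2)[of "f x" "f y"] bij bij_betw_inv_into_right[OF h(1)] that
    by (auto simp: f_def bij_betw_def)
  have inj: "inj_on f (pverts H)" using bij by (simp add: bij_betw_def)
  have f_eq: "f x = f y \<longleftrightarrow> x = y" if "x \<in> pverts H" "y \<in> pverts H" for x y
    using inj_on_eq_iff[OF inj] that by blast
  define N' where "N' x = N (h x)" for x
  have N': "N' (f v) = N v" if "v \<in> Q" for v
    using bij_betw_inv_into_right[OF h(1) QH[OF that]] by (simp add: f_def N'_def)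
  have "path_clique G D (f \<circ> u) (f ` Q) N'"
    unfolding path_clique_def
  proof (intro conjI)
    show "inj_on (f \<circ> u) {..D}"
      using pc inj V by (intro comp_inj_on) (auto simp: path_clique_def intro: inj_on_subset)
    show "pverts G = (f \<circ> u) ` {..D} \<union> f ` Q"
      using bij V by (auto simp: bij_betw_def image_Un image_comp)
    show "(f \<circ> u) ` {..D} \<inter> f ` Q = {}"
      using pc f_eq inH QH by (auto simp: path_clique_def)
    show "\<forall>i\<le>D. \<forall>j\<le>D. ((f \<circ> u) i, (f \<circ> u) j) \<in> parcs G \<longleftrightarrow> i = Suc j \<or> j = Suc i"
      using pc arc inH by (simp add: path_clique_def)
    show "\<forall>v\<in>f ` Q. N' v \<subseteq> {..D} \<and> (\<forall>j\<le>D. ((v, (f \<circ> u) j) \<in> parcs G \<longleftrightarrow> j \<in> N' v) \<and>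
        (((f \<circ> u) j, v) \<in> parcs G \<longleftrightarrow> j \<in> N' v)) \<and>
        (\<forall>w\<in>f ` Q. (v, w) \<in> parcs G \<longleftrightarrow> v \<noteq> w)"
      using pc arc inH QH N' f_eq by (simp add: path_clique_def)
  qed
  moreover have "bij_betw f Q (f ` Q)" using inj V by (intro bij_betw_imageI inj_on_subset[OF inj]) auto
  ultimately show ?thesis using N' by blast
qed

text \<open>All arcs are determined by the sets \<open>N v\<close>, so a bijection of the cliques
  that respects them extends to the paths by sending \<open>u i\<close> to
  \<open>u' i\<close>.\<close>

lemma path_clique_iso:
  assumes G: "pair_wf_digraph G" and H: "pair_wf_digraph H"
    and pG: "path_clique G D u Q N" and pH: "path_clique H D u' Q' N'"
    and \<sigma>: "bij_betw \<sigma> Q Q'" "\<And>v. v \<in> Q \<Longrightarrow> N' (\<sigma> v) = N v"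
  shows "digraph_iso (with_proj G) (with_proj H)"
proof -
  define f where "f x = (if x \<in> Q then \<sigma> x else u' (inv_into {..D} u x))" for x
  have fQ: "f v = \<sigma> v" if "v \<in> Q" for v using that by (simp add: f_def)
  have fu: "f (u i) = u' i" if "i \<le> D" for i
  proof -
    have "u i \<notin> Q" "inj_on u {..D}" using pG that by (auto simp: path_clique_def)
    then show ?thesis using that by (simp add: f_def)
  qed
  have \<sigma>Q: "\<sigma> v \<in> Q'" if "v \<in> Q" for v using \<sigma>(1) that by (auto simp: bij_betw_def)
  have \<sigma>_eq: "\<sigma> v = \<sigma> w \<longleftrightarrow> v = w" if "v \<in> Q" "w \<in> Q" for v w
    using \<sigma>(1) that by (auto simp: bij_betw_def inj_on_def)
  have V: "pverts G = u ` {..D} \<union> Q" using pG by (simp add: path_clique_def)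
  have "bij_betw f (u ` {..D}) (u' ` {..D})"
  proof (rule bij_betw_imageI)
    show "inj_on f (u ` {..D})"
      using pH fu by (auto simp: inj_on_def path_clique_def)
    show "f ` u ` {..D} = u' ` {..D}" using fu by (force simp: image_image)
  qed
  moreover have "bij_betw f Q Q'" using \<sigma>(1) bij_betw_cong[of Q f \<sigma>] fQ by simp
  ultimately have "bij_betw f (u ` {..D} \<union> Q) (u' ` {..D} \<union> Q')"
    using pH by (intro bij_betw_combine) (auto simp: path_clique_def)
  then have "bij_betw f (pverts G) (pverts H)" using pG pH by (simp add: path_clique_def)
  moreover have "(x, y) \<in> parcs G \<longleftrightarrow> (f x, f y) \<in> parcs H"
    if xG: "x \<in> pverts G" and yG: "y \<in> pverts G" for x y
  proof -
    have cs: "(\<exists>i\<le>D. z = u i) \<or> z \<in> Q" if "z \<in> pverts G" for z using that V by auto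
    consider i j where "i \<le> D" "x = u i" "j \<le> D" "y = u j"
      | i where "i \<le> D" "x = u i" "y \<in> Q" | j where "x \<in> Q" "j \<le> D" "y = u j"
      | "x \<in> Q" "y \<in> Q"
      using cs[OF xG] cs[OF yG] by blast
    then show ?thesis
    proof cases
      case 1
      then show ?thesis using pG pH fu by (simp add: path_clique_def)
    next
      case 2
      then show ?thesis using pG pH fu fQ \<sigma>Q \<sigma>(2) by (simp add: path_clique_def)
    next
      case 3
      then show ?thesis using pG pH fu fQ \<sigma>Q \<sigma>(2) by (simp add: path_clique_def)
    next
      case 4
      then show ?thesis using pG pH fQ \<sigma>Q \<sigma>_eq by (simp add: path_clique_def)
    qed
  qed
  ultimately show ?thesis unfolding digraph_iso_iff[OF G H] by blast
qed

lemma path_clique_connected: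
  assumes "pair_graph G" and pc: "path_clique G D u Q N" and N: "\<And>v. v \<in> Q \<Longrightarrow> N v \<noteq> {}"
  shows "Digraph_Component.connected (with_proj G)"
proof -
  interpret pair_graph G by fact
  have V: "pverts G = u ` {..D} \<union> Q" using pc by (simp add: path_clique_def)
  have arc: "x \<rightarrow>\<^sup>*\<^bsub>G\<^esub> y" if "(x, y) \<in> parcs G" for x y
    using that reachable_adjI by simp
  have path: "u 0 \<rightarrow>\<^sup>*\<^bsub>G\<^esub> u j" if "j \<le> D" for j
    using that
  proof (induction j)
    case 0
    then show ?case using V by auto
  next
    case (Suc j)
    then have "(u j, u (Suc j)) \<in> parcs G" using pc by (simp add: path_clique_def)
    moreover have "u 0 \<rightarrow>\<^sup>*\<^bsub>G\<^esub> u j" using Suc by simp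
    ultimately show ?case using reachable_trans[OF _ arc] by blast
  qed
  have from0: "u 0 \<rightarrow>\<^sup>*\<^bsub>G\<^esub> x" if x: "x \<in> pverts G" for x
  proof (cases "x \<in> Q")
    case True
    moreover from this have "N x \<subseteq> {..D}" using pc by (simp add: path_clique_def)
    ultimately obtain j where j: "j \<in> N x" "j \<le> D" using N[of x] by auto
    then have "(u j, x) \<in> parcs G" using pc True by (simp add: path_clique_def)
    then show ?thesis using reachable_trans[OF path[OF j(2)] arc] by blast
  next
    case False
    then show ?thesis using x V path by auto
  qed
  \<comment> \<open>Connectedness is defined through the symmetric closure, and a pair graph is its
    own closure.\<close>
  have "mk_symmetric (with_proj G) = G"
    using adj_mk_symmetric_eq[OF sym_arcs] by (cases G) (simp add: mk_symmetric_def)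
  moreover have "x \<rightarrow>\<^sup>*\<^bsub>G\<^esub> y" if "x \<in> pverts G" "y \<in> pverts G" for x y
    using reachable_trans[OF symmetric_reachable[OF sym_arcs from0[OF that(1)]] from0[OF that(2)]] .
  ultimately show ?thesis using V
    unfolding Digraph_Component.connected_def strongly_connected_def by auto
qed

text \<open>Reading the path backwards turns attachments at the right end into attachments at the
  left end.\<close>

lemma path_clique_reverse:
  assumes "path_clique G D u Q N"
  shows "path_clique G D (\<lambda>i. u (D - i)) Q (\<lambda>v. (\<lambda>j. D - j) ` N v)"
proof -
  have rev: "(\<lambda>i. D - i) ` {..D} = {..D}" by (force intro: image_eqI[of x _ "D - x" for x])
  have "(\<lambda>i. u (D - i)) ` {..D} = u ` {..D}"
    using rev by (metis image_image)
  moreover have "inj_on (\<lambda>i. u (D - i)) {..D}"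
  proof (rule inj_onI)
    fix i j assume "i \<in> {..D}" "j \<in> {..D}" "u (D - i) = u (D - j)"
    moreover from this have "D - i = D - j"
      using assms by (intro inj_onD[of u "{..D}"]) (auto simp: path_clique_def)
    ultimately show "i = j" by auto
  qed
  moreover have "(D - i = Suc (D - j) \<or> D - j = Suc (D - i)) \<longleftrightarrow> (i = Suc j \<or> j = Suc i)"
    if "i \<le> D" "j \<le> D" for i j using that by auto
  moreover have "D - j \<in> N v \<longleftrightarrow> j \<in> (\<lambda>j. D - j) ` N v" if "v \<in> Q" "j \<le> D" for v j
  proof -
    have "N v \<subseteq> {..D}" using assms that by (simp add: path_clique_def)
    then show ?thesis using that by (auto intro: image_eqI[of _ _ "D - j"])
  qed
  moreover have "(\<lambda>j. D - j) ` N v \<subseteq> {..D}" for v by auto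
  ultimately show ?thesis using assms by (simp add: path_clique_def)
qed

section \<open>The index of graphs with a clique at the path ends\<close>

lemma nbr_sets_distinct:
  "{0, 1, 2} \<noteq> {0, 1 :: nat}" "{1, 2, 3} \<noteq> {0, 1 :: nat}" "{1, 2, 3} \<noteq> {0, 1, 2 :: nat}"
proof -
  have "2 \<notin> {0, 1 :: nat}" "0 \<notin> {1, 2, 3 :: nat}" by simp_all
  then show "{0, 1, 2} \<noteq> {0, 1 :: nat}" "{1, 2, 3} \<noteq> {0, 1 :: nat}" "{1, 2, 3} \<noteq> {0, 1, 2 :: nat}"
    by blast+
qed

text \<open>Covers all extremal graphs, the third alternative serving \<open>H2\<close> and
  \<open>H3\<close>. The last conjunct forbids mixing \<open>{0, 1}\<close> with
  \<open>{1, 2, 3}\<close>: a vertex of the first kind would then reach \<open>u 3\<close> in two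
  steps through the clique and have eccentricity below \<open>D\<close>.\<close>

definition end_attached :: "nat \<Rightarrow> 'a set \<Rightarrow> ('a \<Rightarrow> nat set) \<Rightarrow> bool" where
  "end_attached D Q N \<longleftrightarrow>
    (\<forall>v\<in>Q. N v = {0, 1} \<or> N v = {0, 1, 2} \<or> D = 3 \<and> N v = {1, 2, 3}) \<and>
    ((\<exists>v\<in>Q. 3 \<in> N v) \<longrightarrow> (\<forall>v\<in>Q. N v \<noteq> {0, 1}))"

text \<open>No path vertex has an excess, and every \<open>v\<close> in \<open>Q\<close> attains the
  bound for its number of path neighbours. The function \<open>b\<close> is left open to serve both
  the mixed sums of \<open>G_graph\<close> and the constant \<open>rest_bound\<close>.\<close>

lemma end_attached_index:
  assumes G: "pair_graph G" and D3: "3 \<le> D" and pc: "path_clique G D u Q N"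
    and ends: "end_attached D Q N"
    and M2: "\<And>v. \<lbrakk>v \<in> Q; card (N v) = 2\<rbrakk> \<Longrightarrow> b v = two_nbr_bound D (card Q)"
    and M3: "\<And>v. \<lbrakk>v \<in> Q; card (N v) = 3\<rbrakk> \<Longrightarrow> b v = three_nbr_bound D (card Q)"
  shows "ecc_conn_index (with_proj G) = path_index D + (\<Sum>v\<in>Q. b v)"
proof -
  interpret pair_graph G by fact
  have Nc: "N v = {0, 1} \<or> N v = {0, 1, 2} \<or> D = 3 \<and> N v = {1, 2, 3}" if "v \<in> Q" for v
    using ends that unfolding end_attached_def by blast
  have conn: "Digraph_Component.connected (with_proj G)"
    using Nc by (intro path_clique_connected[OF G pc]) blast
  interpret graph_metric "pverts G" "gdist G" using graph_metric_gdist[OF conn] .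
  have V: "pverts G = u ` {..D} \<union> Q" and dj: "u ` {..D} \<inter> Q = {}" and inj: "inj_on u {..D}"
    using pc by (auto simp: path_clique_def)
  have uQ: "u i \<notin> Q" and uV: "u i \<in> pverts G" if "i \<le> D" for i using dj V that by auto
  have QV: "v \<in> pverts G" if "v \<in> Q" for v using V that by auto
  have arc_uu: "(u i, u j) \<in> parcs G \<longleftrightarrow> i = Suc j \<or> j = Suc i" if "i \<le> D" "j \<le> D" for i j
    using pc that by (simp add: path_clique_def)
  have arc_Qu: "(v, u j) \<in> parcs G \<longleftrightarrow> j \<in> N v" "(u j, v) \<in> parcs G \<longleftrightarrow> j \<in> N v"
    if "v \<in> Q" "j \<le> D" for v j using pc that by (simp_all add: path_clique_def)
  have arc_QQ: "(v, w) \<in> parcs G \<longleftrightarrow> v \<noteq> w" if "v \<in> Q" "w \<in> Q" for v w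
    using pc that by (simp add: path_clique_def)
  have dQQ: "gdist G v w = (if v = w then 0 else 1)" if "v \<in> Q" "w \<in> Q" for v w
    using that gdist_eq_1_iff[OF conn, of v w] arc_QQ d_self QV by auto
  \<comment> \<open>A 1-Lipschitz potential extending \<open>u i \<mapsto> i\<close>, which yields all lower bounds on distances.\<close>
  define \<phi> where "\<phi> x = (if x \<in> Q then if N x = {0, 1} then 0 else if N x = {0, 1, 2} then 1 else 2
    else inv_into {..D} u x)" for x
  have \<phi>u: "\<phi> (u i) = i" if "i \<le> D" for i using that uQ inj by (simp add: \<phi>_def)
  have \<phi>Q: "N v = {0, 1} \<and> \<phi> v = 0 \<or> N v = {0, 1, 2} \<and> \<phi> v = 1 \<or> D = 3 \<and> N v = {1, 2, 3} \<and> \<phi> v = 2"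
    if "v \<in> Q" for v
    using Nc[OF that] that nbr_sets_distinct by (simp only: \<phi>_def) metis
  have \<phi>QN: "\<phi> v \<le> Suc j \<and> j \<le> Suc (\<phi> v)" if "v \<in> Q" "j \<in> N v" for v j
    using \<phi>Q[OF that(1)] that(2) by (elim disjE conjE) auto
  have \<phi>QQ: "\<phi> v \<le> Suc (\<phi> w)" if "v \<in> Q" "w \<in> Q" for v w
  proof (cases "N v = {1, 2, 3}")
    case True
    then have "N w \<noteq> {0, 1}" using ends that unfolding end_attached_def by blast
    then have "1 \<le> \<phi> w" using \<phi>Q[OF that(2)] by linarith
    then show ?thesis using \<phi>Q[OF that(1)] by linarith
  next
    case False
    then show ?thesis using \<phi>Q[OF that(1)] by linarith
  qed
  have lip: "\<phi> x \<le> Suc (\<phi> y)" if x: "x \<in> pverts G" and y: "y \<in> pverts G" and 1: "gdist G x y = 1" for x y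
  proof -
    have a: "(x, y) \<in> parcs G" using 1 gdist_eq_1_iff[OF conn x y] by simp
    have cs: "(\<exists>i\<le>D. z = u i) \<or> z \<in> Q" if "z \<in> pverts G" for z using that V by auto
    consider i j where "i \<le> D" "x = u i" "j \<le> D" "y = u j"
      | i where "i \<le> D" "x = u i" "y \<in> Q" | j where "x \<in> Q" "j \<le> D" "y = u j"
      | "x \<in> Q" "y \<in> Q"
      using cs[OF x] cs[OF y] by blast
    then show ?thesis
    proof cases
      case 1
      then show ?thesis using a arc_uu \<phi>u by auto
    next
      case 2
      then show ?thesis using a arc_Qu \<phi>u \<phi>QN by auto
    next
      case 3
      then show ?thesis using a arc_Qu \<phi>u \<phi>QN by auto
    next
      case 4
      then show ?thesis using \<phi>QQ by simp
    qed
  qed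
  have low: "\<phi> x \<le> \<phi> y + gdist G x y" if "x \<in> pverts G" "y \<in> pverts G" for x y
    using lipschitz_le_d[of \<phi>] lip that by blast
  have up: "gdist G (u i) (u (i + k)) \<le> k" if "i + k \<le> D" for i k
    using that
  proof (induction k)
    case 0
    then show ?case using d_self uV by simp
  next
    case (Suc k)
    have "gdist G (u (i + k)) (u (i + Suc k)) = 1"
      using gdist_eq_1_iff[OF conn uV uV] arc_uu Suc.prems by simp
    then show ?case
      using d_triangle[OF uV uV uV, of i "i + k" "i + Suc k"] Suc by simp
  qed
  have geo: "gdist G (u i) (u j) = j - i" if "i \<le> j" "j \<le> D" for i j
  proof (rule antisym)
    show "gdist G (u i) (u j) \<le> j - i" using up[of i "j - i"] that by simp
    show "j - i \<le> gdist G (u i) (u j)"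
      using low[OF uV uV, of j i] \<phi>u d_commute[OF uV uV, of i j] that by simp
  qed
  interpret P: geodesic "pverts G" "gdist G" D u
    using D3 uV geo by unfold_locales auto
  have "pverts G - u ` {..D} = Q" using V dj by auto
  then have rest: "P.rest = Q" by (simp only: P.rest_def)
  have PN: "P.N v = N v" if "v \<in> Q" for v
  proof -
    have "N v \<subseteq> {..D}" using pc that by (simp add: path_clique_def)
    then show ?thesis
      using gdist_eq_1_iff[OF conn QV[OF that] uV] arc_Qu that by (auto simp: P.N_def)
  qed
  have dQu: "gdist G v (u j) \<le> 1 + (i - j) + (j - i)" if "v \<in> Q" "i \<in> N v" "j \<le> D" for v i j
    using P.d_rest_u_le[of v i j] that rest PN by simp
  have ec_u: "ec (u j) = path_ecc D j" if j: "j \<le> D" for j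
  proof -
    have "gdist G (u j) z \<le> path_ecc D j" if z: "z \<in> pverts G" for z
      using z
    proof (cases rule: P.V_cases)
      case (path i)
      then show ?thesis using P.d_u_le_path_ecc j by simp
    next
      case rest
      then have zQ: "z \<in> Q" using \<open>P.rest = Q\<close> by simp
      \<comment> \<open>Two path neighbours at one end put \<open>z\<close> no farther from
        \<open>u j\<close> than that end is, unless \<open>u j\<close> is that end itself, where the
        distance is at most 1.\<close>
      consider "0 \<in> N z" "1 \<in> N z" | "D = 3" "2 \<in> N z" "3 \<in> N z" using Nc[OF zQ] by blast
      then have "gdist G z (u j) \<le> path_ecc D j"
      proof cases
        case 1
        then show ?thesis using dQu[OF zQ, of 0 j] dQu[OF zQ, of 1 j] j D3
          by (cases "j = 0") (simp_all add: path_ecc_def le_max_iff_disj)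
      next
        case 2
        then show ?thesis using dQu[OF zQ, of 2 j] dQu[OF zQ, of 3 j] j
          by (cases "j = 3") (auto simp: path_ecc_def le_max_iff_disj)
      qed
      then show ?thesis using d_commute[OF z uV[OF j]] by simp
    qed
    then have "ec (u j) \<le> path_ecc D j" using ec_attained[OF uV[OF j]] by metis
    then show ?thesis using P.path_ecc_le_ec[OF j] by simp
  qed
  have "P.c v = b v" if v: "v \<in> Q" for v
  proof -
    have deg: "deg v + 1 = card (N v) + card Q"
    proof -
      have "{x \<in> Q. gdist G v x = 1} = Q - {v}" using dQQ v by auto
      moreover have "finite Q" using finite_V V by simp
      ultimately have "card {x \<in> Q. gdist G v x = 1} + 1 = card Q"
        using v card_Suc_Diff1[of Q v] by simp
      then show ?thesis using P.deg_rest[of v] rest PN v by simp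
    qed
    have c: "P.c v = (\<Sum>j\<in>N v. path_ecc D j) + deg v * ec v"
      using ec_u P.N_le[of _ v] unfolding P.c_def PN[OF v, symmetric] by simp
    have ecv: "ec v = k"
      if k: "\<And>j. j \<le> D \<Longrightarrow> gdist G v (u j) \<le> k" "1 \<le> k" and y: "y \<in> pverts G" "k \<le> gdist G v y" for k y
    proof (rule ec_eqI[OF y(1)])
      have "gdist G v z \<le> k" if "z \<in> pverts G" for z
        using that
      proof (cases rule: P.V_cases)
        case (path i)
        then show ?thesis using k by simp
      next
        case rest
        then show ?thesis using dQQ[OF v, of z] \<open>P.rest = Q\<close> k(2) by simp
      qed
      then show "gdist G v z \<le> k" if "z \<in> pverts G" for z using that .
      then show "gdist G v y = k" using y by (simp add: antisym)
    qed
    \<comment> \<open>The gap between \<open>\<phi> v\<close> and the index of the path end farther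
      from \<open>v\<close> is the eccentricity of \<open>v\<close>.\<close>
    consider (two) "N v = {0, 1}" "\<phi> v = 0" | (left) "N v = {0, 1, 2}" "\<phi> v = 1"
      | (right) "D = 3" "N v = {1, 2, 3}" "\<phi> v = 2"
      using \<phi>Q[OF v] by metis
    then show ?thesis
    proof cases
      case two
      have "ec v = D"
      proof (rule ecv)
        show "gdist G v (u j) \<le> D" if "j \<le> D" for j
          using dQu[OF v, of 0 j] dQu[OF v, of 1 j] two(1) that D3 by simp
        show "D \<le> gdist G v (u D)"
          using low[OF uV QV[OF v], of D] \<phi>u[of D] d_commute[OF uV QV[OF v], of D] two(2) by simp
      qed (use uV D3 in auto)
      then show ?thesis
        using two c deg M2[OF v] D3 by (simp add: two_nbr_bound_def path_ecc_def)
    next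
      case left
      have "ec v = D - 1"
      proof (rule ecv)
        show "gdist G v (u j) \<le> D - 1" if "j \<le> D" for j
          using dQu[OF v, of 0 j] dQu[OF v, of 1 j] dQu[OF v, of 2 j] left(1) that D3 by simp
        show "D - 1 \<le> gdist G v (u D)"
          using low[OF uV QV[OF v], of D] \<phi>u[of D] d_commute[OF uV QV[OF v], of D] left(2) by simp
      qed (use uV D3 in auto)
      then show ?thesis
        using left c deg M3[OF v] D3 by (simp add: three_nbr_bound_def path_ecc_def) linarith
    next
      case right
      have "ec v = 2"
      proof (rule ecv)
        have "1 \<in> N v" "2 \<in> N v" "3 \<in> N v" using right(2) by simp_all
        then show "gdist G v (u j) \<le> 2" if "j \<le> D" for j
          using dQu[OF v _ that, of 1] dQu[OF v _ that, of 2] dQu[OF v _ that, of 3] right(1) that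
          by linarith
        show "2 \<le> gdist G v (u 0)"
          using low[OF QV[OF v] uV, of 0] \<phi>u[of 0] right(3) by simp
      qed (use uV in auto)
      then show ?thesis
        using right c deg M3[OF v] by (simp add: three_nbr_bound_def path_ecc_def)
    qed
  qed
  then have "xi = path_index D + (\<Sum>v\<in>Q. b v)"
    unfolding P.xi_decomp rest path_index_def using ec_u by simp
  then show ?thesis using ecc_conn_index_eq_xi[OF conn] by simp
qed

text \<open>With only two possible neighbour sets, equal sizes of the cliques and of their
  \<open>S\<close> parts give a type-preserving bijection, assembled from one bijection per
  type.\<close>

lemma path_clique_iso_two_types:
  assumes G: "pair_wf_digraph G" and H: "pair_wf_digraph H"
    and pG: "path_clique G D u Q N" and pH: "path_clique H D u' Q' N'"
    and fin: "finite Q" "finite Q'" and card: "card Q = card Q'"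
    and N: "\<And>v. v \<in> Q \<Longrightarrow> N v = S \<or> N v = T" and N': "\<And>v. v \<in> Q' \<Longrightarrow> N' v = S \<or> N' v = T"
    and cardS: "card {v \<in> Q. N v = S} = card {v \<in> Q'. N' v = S}"
  shows "digraph_iso (with_proj G) (with_proj H)"
proof -
  let ?X = "{v \<in> Q. N v = S}" and ?X' = "{v \<in> Q'. N' v = S}"
  obtain g where g: "bij_betw g ?X ?X'"
    using finite_same_card_bij[OF _ _ cardS] fin by auto
  have "card (Q - ?X) = card (Q' - ?X')"
    using fin card cardS by (simp add: card_Diff_subset)
  then obtain h where h: "bij_betw h (Q - ?X) (Q' - ?X')"
    using finite_same_card_bij fin by (metis finite_Diff)
  define \<sigma> where "\<sigma> x = (if x \<in> ?X then g x else h x)" for x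
  have "bij_betw \<sigma> (?X \<union> (Q - ?X)) (?X' \<union> (Q' - ?X'))"
    unfolding \<sigma>_def by (intro bij_betw_disjoint_Un g h) auto
  moreover have "?X \<union> (Q - ?X) = Q" "?X' \<union> (Q' - ?X') = Q'" by auto
  ultimately have \<sigma>: "bij_betw \<sigma> Q Q'" by (simp only:)
  have "N' (\<sigma> v) = N v" if v: "v \<in> Q" for v
  proof (cases "N v = S")
    case True
    then have "g v \<in> ?X'" using g v by (intro bij_betw_apply[OF g]) simp
    then show ?thesis using True v by (simp add: \<sigma>_def)
  next
    case False
    then have "h v \<in> Q' - ?X'" using v by (intro bij_betw_apply[OF h]) simp
    then have "N' (h v) = T" using N' by blast
    then show ?thesis using False N[OF v] by (simp add: \<sigma>_def)
  qed
  then show ?thesis by (rule path_clique_iso[OF G H pG pH \<sigma>])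
qed

section \<open>The extremal graphs\<close>

lemma parcs_mk_symmetric_pair:
  "parcs (mk_symmetric (with_proj \<lparr>pverts = W, parcs = R\<rparr>)) = R \<union> R\<inverse>"
  by (auto simp: parcs_mk_symmetric)

lemma pair_graph_mk_symmetric:
  assumes "finite W" "R \<subseteq> W \<times> W" "\<And>x. (x, x) \<notin> R"
  shows "pair_graph (mk_symmetric (with_proj \<lparr>pverts = W, parcs = R\<rparr>))"
proof -
  have "finite (R \<union> R\<inverse>)" using assms finite_subset[OF assms(2)] by simp
  moreover have "fst e \<in> W \<and> snd e \<in> W \<and> fst e \<noteq> snd e" if "e \<in> R \<union> R\<inverse>" for e
    using that assms by (cases e) auto
  ultimately show ?thesis
    using assms(1) symmetric_mk_symmetric by unfold_locales (simp_all add: parcs_mk_symmetric_pair)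
qed

lemma G_graph_arc_iff:
  "(x, y) \<in> parcs (G_graph n D k) \<longleftrightarrow>
    y = Suc x \<and> x < D \<or> x = Suc y \<and> y < D \<or>
    D < x \<and> x < n \<and> D < y \<and> y < n \<and> x \<noteq> y \<or>
    D < x \<and> x < n \<and> y \<le> 1 \<or> D < y \<and> y < n \<and> x \<le> 1 \<or>
    D < x \<and> x \<le> D + k \<and> y = 2 \<or> D < y \<and> y \<le> D + k \<and> x = 2"
proof -
  have R: "(a, b) \<in> {(i, Suc i) | i. i < D} \<union> {(x, y) | x y. D < x \<and> x < y \<and> y < n}
      \<union> {D<..<n} \<times> {0, 1} \<union> {D<..D + k} \<times> {2} \<longleftrightarrow>
    b = Suc a \<and> a < D \<or> D < a \<and> a < b \<and> b < n \<or> D < a \<and> a < n \<and> (b = 0 \<or> b = 1) \<or>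
    D < a \<and> a \<le> D + k \<and> b = 2" for a b
    by simp
  have le1: "b \<le> 1 \<longleftrightarrow> b = 0 \<or> b = 1" for b :: nat by linarith
  have ne: "D < x \<and> x < n \<and> D < y \<and> y < n \<and> x \<noteq> y \<longleftrightarrow> D < x \<and> x < y \<and> y < n \<or> D < y \<and> y < x \<and> x < n"
    by auto
  show ?thesis
    unfolding G_graph_def parcs_mk_symmetric_pair Un_iff[of _ _ "_\<inverse>"] converse_iff R le1 ne
    by argo
qed

lemma pverts_G_graph: "pverts (G_graph n D k) = {..<n}"
  by (simp add: G_graph_def)

lemma pair_graph_G_graph:
  assumes "3 \<le> D" "D < n" "k \<le> n - D - 1"
  shows "pair_graph (G_graph n D k)"
  unfolding G_graph_def using assms by (intro pair_graph_mk_symmetric) auto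

definition G_nbrs :: "nat \<Rightarrow> nat \<Rightarrow> nat \<Rightarrow> nat set" where
  "G_nbrs D k v = (if v \<le> D + k then {0, 1, 2} else {0, 1})"

lemma mem_G_nbrs: "j \<in> G_nbrs D k v \<longleftrightarrow> j \<le> 1 \<or> j = 2 \<and> v \<le> D + k"
  by (auto simp: G_nbrs_def)

lemma path_clique_G_graph:
  assumes "3 \<le> D" "D < n" "k \<le> n - D - 1"
  shows "path_clique (G_graph n D k) D (\<lambda>i. i) {D<..<n} (G_nbrs D k)"
  unfolding path_clique_def G_graph_arc_iff pverts_G_graph
  using assms by (auto simp: mem_G_nbrs)

lemma end_attached_G_nbrs: "3 \<le> D \<Longrightarrow> end_attached D {D<..<n} (G_nbrs D k)"
  by (auto simp: end_attached_def mem_G_nbrs)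

lemma card_G_nbrs: "card (G_nbrs D k v) = (if v \<le> D + k then 3 else 2)"
  by (simp add: G_nbrs_def)

lemma index_G_graph:
  assumes "3 \<le> D" "D < n" "k \<le> n - D - 1"
  shows "ecc_conn_index (with_proj (G_graph n D k)) = path_index D +
    k * three_nbr_bound D (n - D - 1) + (n - D - 1 - k) * two_nbr_bound D (n - D - 1)"
proof -
  let ?m = "n - D - 1"
  have "ecc_conn_index (with_proj (G_graph n D k)) = path_index D +
      (\<Sum>v\<in>{D<..<n}. if v \<le> D + k then three_nbr_bound D ?m else two_nbr_bound D ?m)"
    by (rule end_attached_index[OF pair_graph_G_graph[OF assms] assms(1) path_clique_G_graph[OF assms]
          end_attached_G_nbrs[OF assms(1)]])
      (simp_all add: card_G_nbrs split: if_splits)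
  also have "(\<Sum>v\<in>{D<..<n}. if v \<le> D + k then three_nbr_bound D ?m else two_nbr_bound D ?m)
      = card ({D<..<n} \<inter> {v. v \<le> D + k}) * three_nbr_bound D ?m
        + card ({D<..<n} \<inter> - {v. v \<le> D + k}) * two_nbr_bound D ?m"
    by (simp add: sum.If_cases)
  also have "{D<..<n} \<inter> {v. v \<le> D + k} = {D<..D + k}" using assms by auto
  also have "{D<..<n} \<inter> - {v. v \<le> D + k} = {D + k<..<n}" by auto
  finally show ?thesis by simp
qed

text \<open>The index of \<open>G_graph n D k\<close> is affine in \<open>k\<close>, so the maximum
  is attained at \<open>k = 0\<close> or at \<open>k = n - D - 1\<close>.\<close>

lemma f_max_eq:
  assumes "3 \<le> D" "D < n"
  shows "f_max n D = path_index D + (n - D - 1) * rest_bound D (n - D - 1)"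
proof -
  let ?m = "n - D - 1" and ?A = "two_nbr_bound D (n - D - 1)" and ?B = "three_nbr_bound D (n - D - 1)"
  let ?g = "\<lambda>k. path_index D + k * ?B + (?m - k) * ?A"
  have "f_max n D = Max (?g ` {0..?m})"
    unfolding f_max_def using index_G_graph[OF assms] by (intro arg_cong[of _ _ Max] image_cong) auto
  also have "\<dots> = path_index D + ?m * max ?A ?B"
  proof (rule Max_eqI)
    fix y assume "y \<in> ?g ` {0..?m}"
    then obtain k where k: "k \<le> ?m" "y = ?g k" by auto
    have "k * ?B + (?m - k) * ?A \<le> k * max ?A ?B + (?m - k) * max ?A ?B"
      by (intro add_mono mult_le_mono2) auto
    also have "\<dots> = ?m * max ?A ?B" using k(1) by (metis add_mult_distrib le_add_diff_inverse)
    finally show "y \<le> path_index D + ?m * max ?A ?B" using k by simp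
  next
    show "path_index D + ?m * max ?A ?B \<in> ?g ` {0..?m}"
    proof (cases "?A \<le> ?B")
      case True
      then show ?thesis by (intro image_eqI[of _ _ ?m]) (simp_all add: max_def)
    next
      case False
      then show ?thesis by (intro image_eqI[of _ _ 0]) (simp_all add: max_def)
    qed
  qed simp
  finally show ?thesis by (simp add: rest_bound_def)
qed

section \<open>The sporadic graphs and the case table\<close>

lemma all_le_3_iff: "(\<forall>i\<le>3. P i) \<longleftrightarrow> P 0 \<and> P 1 \<and> P 2 \<and> P (3 :: nat)"
  by (auto simp: le_Suc_eq numeral_3_eq_3 numeral_2_eq_2)

lemma atMost_3: "{..3 :: nat} = {0, 1, 2, 3}"
  by auto

lemma pair_graph_H2: "pair_graph H2"
  unfolding H2_def by (intro pair_graph_mk_symmetric) auto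

lemma pair_graph_H3: "pair_graph H3"
  unfolding H3_def by (intro pair_graph_mk_symmetric) auto

lemma path_clique_H2:
  "path_clique H2 3 (\<lambda>i. i) {4, 5} (\<lambda>v. if v = 4 then {0, 1, 2} else {1, 2, 3})"
  unfolding path_clique_def all_le_3_iff H2_def parcs_mk_symmetric_pair
  by (simp add: atMost_3) auto

text \<open>The path in \<open>H3\<close> is \<open>a, 3, 4, b\<close>.\<close>

lemma path_clique_H3:
  "path_clique H3 3 (\<lambda>i. [6, 3, 4, 7] ! i) {1, 2, 5} (\<lambda>v. if v = 5 then {1, 2, 3} else {0, 1, 2})"
  unfolding path_clique_def all_le_3_iff H3_def parcs_mk_symmetric_pair
  by (simp add: atMost_3) auto

text \<open>As integers, \<open>three_nbr_bound D m - two_nbr_bound D m\<close> equals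
  \<open>max 2 (D - 2) + D - (m + 2)\<close>. For \<open>D = 3\<close> the maximum is 2 instead of
  \<open>D - 2\<close>, which moves the threshold from 6 to 7.\<close>

lemma three_le_two_iff:
  assumes "3 \<le> D" "D < n"
  shows "three_nbr_bound D (n - D - 1) \<le> two_nbr_bound D (n - D - 1) \<longleftrightarrow>
    (if D = 3 then 7 \<le> n else 3 * (D - 1) \<le> n)"
    and "two_nbr_bound D (n - D - 1) \<le> three_nbr_bound D (n - D - 1) \<longleftrightarrow>
    (if D = 3 then n \<le> 7 else n \<le> 3 * (D - 1))"
proof -
  define m where "m = n - D - 1"
  have n: "n = m + D + 1" using assms by (simp add: m_def)
  have "three_nbr_bound D m \<le> two_nbr_bound D m \<longleftrightarrow> max 2 (D - 2) + D \<le> m + 2"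
    "two_nbr_bound D m \<le> three_nbr_bound D m \<longleftrightarrow> m + 2 \<le> max 2 (D - 2) + D"
  proof -
    obtain E where "D = Suc E" using assms by (cases D) auto
    then show "three_nbr_bound D m \<le> two_nbr_bound D m \<longleftrightarrow> max 2 (D - 2) + D \<le> m + 2"
      "two_nbr_bound D m \<le> three_nbr_bound D m \<longleftrightarrow> m + 2 \<le> max 2 (D - 2) + D"
      by (simp_all add: three_nbr_bound_def two_nbr_bound_def algebra_simps)
  qed
  then show "three_nbr_bound D (n - D - 1) \<le> two_nbr_bound D (n - D - 1) \<longleftrightarrow>
      (if D = 3 then 7 \<le> n else 3 * (D - 1) \<le> n)"
    "two_nbr_bound D (n - D - 1) \<le> three_nbr_bound D (n - D - 1) \<longleftrightarrow>
      (if D = 3 then n \<le> 7 else n \<le> 3 * (D - 1))"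
    unfolding m_def[symmetric] using n assms(1) by (auto simp: max_def)
qed

text \<open>Uniform version of the case table: a clique vertex with two path neighbours
  (\<open>k < n - D - 1\<close>) may occur only if \<open>two_nbr_bound\<close> is maximal, one with
  three (\<open>0 < k\<close>) only if \<open>three_nbr_bound\<close> is.\<close>

lemma extremal_class_iff:
  assumes "3 \<le> D" "D < n"
  shows "H \<in> extremal_class n D \<longleftrightarrow>
    (\<exists>k\<le>n - D - 1. H = G_graph n D k \<and>
      (k < n - D - 1 \<longrightarrow> three_nbr_bound D (n - D - 1) \<le> two_nbr_bound D (n - D - 1)) \<and>
      (0 < k \<longrightarrow> two_nbr_bound D (n - D - 1) \<le> three_nbr_bound D (n - D - 1))) \<or>
    n = 6 \<and> D = 3 \<and> H = H2 \<or> n = 7 \<and> D = 3 \<and> H = H3"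
    (is "_ \<longleftrightarrow> ?R")
proof -
  \<comment> \<open>When the side conditions leave a single value of \<open>k\<close>, the
    existential collapses to one graph.\<close>
  have uniq: "(\<exists>k\<le>b. H = g k \<and> S k \<and> T k) \<longleftrightarrow> H = g l" if "\<And>k. k \<le> b \<and> S k \<and> T k \<longleftrightarrow> k = l"
    for b l :: nat and g :: "nat \<Rightarrow> nat pair_pre_digraph" and S T
    using that[of l] that by metis
  show ?thesis
  proof (cases "D = 3")
    case D: True
    have R: "?R \<longleftrightarrow> (\<exists>k\<le>n - 4. H = G_graph n 3 k \<and> (k < n - 4 \<longrightarrow> 7 \<le> n) \<and> (0 < k \<longrightarrow> n \<le> 7)) \<or>
        n = 6 \<and> H = H2 \<or> n = 7 \<and> H = H3"
      unfolding three_le_two_iff[OF assms] using D by simp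
    have n4: "4 \<le> n" using assms D by simp
    have k3: "k \<le> 3 \<longleftrightarrow> k = 0 \<or> k = 1 \<or> k = 2 \<or> k = 3" for k :: nat by linarith
    consider "n = 4 \<or> n = 5" | "n = 6" | "n = 7" | "7 < n" using n4 by linarith
    then show ?thesis
    proof cases
      case 1
      then have "(\<exists>k\<le>n - 4. H = G_graph n 3 k \<and> (k < n - 4 \<longrightarrow> 7 \<le> n) \<and> (0 < k \<longrightarrow> n \<le> 7))
          \<longleftrightarrow> H = G_graph n 3 (n - 4)"
        by (intro uniq) auto
      then have "?R \<longleftrightarrow> H = G_graph n 3 (n - 4)" unfolding R using 1 by auto
      then show ?thesis using 1 D by (auto simp: extremal_class_def)
    next
      case 2
      then have "(\<exists>k\<le>n - 4. H = G_graph n 3 k \<and> (k < n - 4 \<longrightarrow> 7 \<le> n) \<and> (0 < k \<longrightarrow> n \<le> 7))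
          \<longleftrightarrow> H = G_graph n 3 (2)"
        by (intro uniq) auto
      then have "?R \<longleftrightarrow> H = G_graph 6 3 2 \<or> H = H2" unfolding R using 2 by simp
      then show ?thesis using 2 D by (simp add: extremal_class_def)
    next
      case 3
      then have "?R \<longleftrightarrow> (\<exists>k\<le>3. H = G_graph 7 3 k) \<or> H = H3" unfolding R by simp
      then show ?thesis using 3 D unfolding k3 by (auto simp: extremal_class_def)
    next
      case 4
      then have "(\<exists>k\<le>n - 4. H = G_graph n 3 k \<and> (k < n - 4 \<longrightarrow> 7 \<le> n) \<and> (0 < k \<longrightarrow> n \<le> 7))
          \<longleftrightarrow> H = G_graph n 3 (0)"
        by (intro uniq) auto
      then have "?R \<longleftrightarrow> H = G_graph n 3 0" unfolding R using 4 by simp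
      then show ?thesis using 4 D by (simp add: extremal_class_def)
    qed
  next
    case False
    then have D: "4 \<le> D" using assms by simp
    have R: "?R \<longleftrightarrow> (\<exists>k\<le>n - D - 1. H = G_graph n D k \<and>
        (k < n - D - 1 \<longrightarrow> 3 * (D - 1) \<le> n) \<and> (0 < k \<longrightarrow> n \<le> 3 * (D - 1)))"
      unfolding three_le_two_iff[OF assms] using False by simp
    consider "n < 3 * (D - 1)" | "n = 3 * (D - 1)" | "3 * (D - 1) < n" by linarith
    then show ?thesis
    proof cases
      case 1
      then have "(\<exists>k\<le>n - D - 1. H = G_graph n D k \<and>
          (k < n - D - 1 \<longrightarrow> 3 * (D - 1) \<le> n) \<and> (0 < k \<longrightarrow> n \<le> 3 * (D - 1))) \<longleftrightarrow> H = G_graph n D (n - D - 1)"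
        by (intro uniq) auto
      then have "?R \<longleftrightarrow> H = G_graph n D (n - D - 1)" unfolding R .
      then show ?thesis using 1 D by (simp add: extremal_class_def)
    next
      case 2
      then have "?R \<longleftrightarrow> (\<exists>k\<le>n - D - 1. H = G_graph n D k)" unfolding R by simp
      moreover have "extremal_class n D = G_graph n D ` {0..n - D - 1}"
        using 2 D by (simp add: extremal_class_def)
      ultimately show ?thesis by auto
    next
      case 3
      then have "(\<exists>k\<le>n - D - 1. H = G_graph n D k \<and>
          (k < n - D - 1 \<longrightarrow> 3 * (D - 1) \<le> n) \<and> (0 < k \<longrightarrow> n \<le> 3 * (D - 1))) \<longleftrightarrow> H = G_graph n D (0)"
        by (intro uniq) auto
      then have "?R \<longleftrightarrow> H = G_graph n D 0" unfolding R .
      then show ?thesis using 3 D by (simp add: extremal_class_def)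
    qed
  qed
qed

text \<open>Prepares \<open>end_attached_index\<close>: whichever numbers of path neighbours occur
  belong to a maximal bound, so every clique vertex contributes \<open>rest_bound\<close>.\<close>

lemma extremal_class_shape:
  assumes "3 \<le> D" "D < n" and H: "H \<in> extremal_class n D"
  shows "pair_graph H \<and> (\<exists>u Q N. path_clique H D u Q N \<and> end_attached D Q N \<and> card Q = n - D - 1 \<and>
    (\<forall>v\<in>Q. (card (N v) = 2 \<longrightarrow> rest_bound D (n - D - 1) = two_nbr_bound D (n - D - 1)) \<and>
           (card (N v) = 3 \<longrightarrow> rest_bound D (n - D - 1) = three_nbr_bound D (n - D - 1))))"
proof -
  show ?thesis
    using H unfolding extremal_class_iff[OF assms(1,2)]
  proof (elim disjE exE conjE)
    fix k assume G: "k \<le> n - D - 1" "H = G_graph n D k"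
      "k < n - D - 1 \<longrightarrow> three_nbr_bound D (n - D - 1) \<le> two_nbr_bound D (n - D - 1)"
      "0 < k \<longrightarrow> two_nbr_bound D (n - D - 1) \<le> three_nbr_bound D (n - D - 1)"
    have "(card (G_nbrs D k v) = 2 \<longrightarrow> rest_bound D (n - D - 1) = two_nbr_bound D (n - D - 1)) \<and>
        (card (G_nbrs D k v) = 3 \<longrightarrow> rest_bound D (n - D - 1) = three_nbr_bound D (n - D - 1))"
      if "v \<in> {D<..<n}" for v
    proof (cases "v \<le> D + k")
      case True
      then show ?thesis using that G(4) by (simp add: card_G_nbrs rest_bound_def)
    next
      case False
      then show ?thesis using that G(1,3) by (simp add: card_G_nbrs rest_bound_def)
    qed
    moreover have "card {D<..<n} = n - D - 1" by simp
    ultimately show ?thesis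
      using G(2) pair_graph_G_graph[OF assms(1,2) G(1)] path_clique_G_graph[OF assms(1,2) G(1)]
        end_attached_G_nbrs[OF assms(1)] by blast
  next
    assume H2: "n = 6" "D = 3" "H = H2"
    let ?N = "\<lambda>v :: nat. if v = 4 then {0, 1, 2} else {1, 2, 3 :: nat}"
    have "end_attached 3 {4, 5} ?N"
      using nbr_sets_distinct by (simp add: end_attached_def)
    moreover have "card (?N v) = 3" for v by simp
    moreover have "rest_bound 3 2 = three_nbr_bound 3 2"
      by (simp add: rest_bound_def two_nbr_bound_def three_nbr_bound_def)
    ultimately show ?thesis using H2 pair_graph_H2 path_clique_H2
      by (intro conjI exI[of _ "\<lambda>i. i"] exI[of _ "{4, 5}"] exI[of _ ?N]) simp_all
  next
    assume H3: "n = 7" "D = 3" "H = H3"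
    let ?N = "\<lambda>v :: nat. if v = 5 then {1, 2, 3} else {0, 1, 2 :: nat}"
    have "end_attached 3 {1, 2, 5} ?N"
      using nbr_sets_distinct by (simp add: end_attached_def)
    moreover have "card (?N v) = 3" for v by simp
    moreover have "rest_bound 3 3 = three_nbr_bound 3 3"
      by (simp add: rest_bound_def two_nbr_bound_def three_nbr_bound_def)
    ultimately show ?thesis using H3 pair_graph_H3 path_clique_H3
      by (intro conjI exI[of _ "\<lambda>i. [6, 3, 4, 7] ! i"] exI[of _ "{1, 2, 5}"] exI[of _ ?N]) simp_all
  qed
qed

lemma iso_extremal_class_imp_index:
  assumes G: "pair_graph G" and D: "3 \<le> D" "D < n"
    and H: "H \<in> extremal_class n D" and iso: "digraph_iso (with_proj G) (with_proj H)"
  shows "ecc_conn_index (with_proj G) = f_max n D"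
proof -
  let ?m = "n - D - 1"
  obtain u Q N where pH: "pair_graph H" and shape: "path_clique H D u Q N" "end_attached D Q N" "card Q = ?m"
      and M: "\<And>v. v \<in> Q \<Longrightarrow> (card (N v) = 2 \<longrightarrow> rest_bound D ?m = two_nbr_bound D ?m) \<and>
             (card (N v) = 3 \<longrightarrow> rest_bound D ?m = three_nbr_bound D ?m)"
    using extremal_class_shape[OF D H] by blast
  interpret G: pair_graph G by (rule G)
  interpret H: pair_graph H by (rule pH)
  obtain f u' N' where f: "bij_betw f Q (f ` Q)" and pc: "path_clique G D u' (f ` Q) N'"
      and N': "\<And>v. v \<in> Q \<Longrightarrow> N' (f v) = N v"
    using path_clique_transport[OF G.pair_wf_digraph H.pair_wf_digraph iso shape(1)] by blast
  have card: "card (f ` Q) = ?m" using bij_betw_same_card[OF f] shape(3) by simp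
  have "end_attached D (f ` Q) N'" using shape(2) N' by (simp add: end_attached_def)
  then have "ecc_conn_index (with_proj G) = path_index D + (\<Sum>v\<in>f ` Q. rest_bound D ?m)"
    using M N' card by (intro end_attached_index[OF G D(1) pc]) auto
  then show ?thesis using f_max_eq[OF D] card by simp
qed

text \<open>The number \<open>k\<close> of clique vertices with three path neighbours identifies the
  graph as \<open>G_graph n D k\<close>; the inequalities attached to the two types place that graph
  in the class.\<close>

lemma one_sided_iso:
  assumes G: "pair_graph G" and D: "3 \<le> D" "D < n" and pc: "path_clique G D u Q N"
    and fin: "finite Q" and card: "card Q = n - D - 1"
    and N: "\<And>v. v \<in> Q \<Longrightarrow>
      N v = {0, 1} \<and> three_nbr_bound D (n - D - 1) \<le> two_nbr_bound D (n - D - 1) \<or>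
      N v = {0, 1, 2} \<and> two_nbr_bound D (n - D - 1) \<le> three_nbr_bound D (n - D - 1)"
  shows "\<exists>H\<in>extremal_class n D. digraph_iso (with_proj G) (with_proj H)"
proof -
  let ?X = "{v \<in> Q. N v = {0, 1, 2}}"
  define k where "k = card ?X"
  have k: "k \<le> n - D - 1" unfolding k_def card[symmetric] using fin by (intro card_mono) auto
  interpret G: pair_graph G by (rule G)
  interpret H: pair_graph "G_graph n D k" by (rule pair_graph_G_graph[OF D k])
  have "{v \<in> {D<..<n}. G_nbrs D k v = {0, 1, 2}} = {D<..D + k}"
  proof (rule set_eqI)
    fix v
    have "G_nbrs D k v = {0, 1, 2} \<longleftrightarrow> v \<le> D + k"
      using nbr_sets_distinct(1) by (metis G_nbrs_def)
    then show "v \<in> {v \<in> {D<..<n}. G_nbrs D k v = {0, 1, 2}} \<longleftrightarrow> v \<in> {D<..D + k}"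
      using k D by auto
  qed
  then have cX: "card ?X = card {v \<in> {D<..<n}. G_nbrs D k v = {0, 1, 2}}"
    by (simp only: k_def[symmetric]) simp
  have iso: "digraph_iso (with_proj G) (with_proj (G_graph n D k))"
  proof (rule path_clique_iso_two_types[OF G.pair_wf_digraph H.pair_wf_digraph pc
        path_clique_G_graph[OF D k] fin _ _ _ _ cX])
    show "card Q = card {D<..<n}" using card by simp
    show "N v = {0, 1, 2} \<or> N v = {0, 1}" if "v \<in> Q" for v using N[OF that] by argo
    show "G_nbrs D k v = {0, 1, 2} \<or> G_nbrs D k v = {0, 1}" for v by (simp add: G_nbrs_def)
  qed simp
  have "three_nbr_bound D (n - D - 1) \<le> two_nbr_bound D (n - D - 1)" if "k < n - D - 1"
  proof -
    have "?X \<noteq> Q" using that card k_def by auto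
    then show ?thesis using N by blast
  qed
  moreover have "two_nbr_bound D (n - D - 1) \<le> three_nbr_bound D (n - D - 1)" if k0: "0 < k"
  proof -
    obtain v where "v \<in> Q" "N v = {0, 1, 2}" using k0 unfolding k_def card_gt_0_iff by blast
    then show ?thesis using N[of v] nbr_sets_distinct by metis
  qed
  ultimately have "G_graph n D k \<in> extremal_class n D"
    unfolding extremal_class_iff[OF D] using k by (intro disjI1 exI[of _ k]) simp
  then show ?thesis using iso by blast
qed

text \<open>Both types occur among at most three clique vertices, so the counts are 1 and 1, which
  gives \<open>H2\<close>, or 2 and 1 in some order, which gives \<open>H3\<close>.\<close>

lemma two_sided_iso:
  assumes G: "pair_graph G" and pc: "path_clique G 3 u Q N" and fin: "finite Q"
    and N: "\<And>v. v \<in> Q \<Longrightarrow> N v = {0, 1, 2} \<or> N v = {1, 2, 3}"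
    and v: "v \<in> Q" "N v = {0, 1, 2}" and w: "w \<in> Q" "N w = {1, 2, 3}"
    and Q3: "card Q \<le> 3"
  shows "\<exists>H\<in>extremal_class (card Q + 4) 3. digraph_iso (with_proj G) (with_proj H)"
proof -
  let ?X = "\<lambda>N. {v \<in> Q. N v = {0, 1, 2}}"
  interpret G: pair_graph G by (rule G)
  interpret H2: pair_graph H2 by (rule pair_graph_H2)
  interpret H3: pair_graph H3 by (rule pair_graph_H3)
  have ne: "v \<noteq> w" using v w nbr_sets_distinct by metis
  have Q2: "2 \<le> card Q" using v w ne card_mono[OF fin, of "{v, w}"] by simp
  have H2: "digraph_iso (with_proj G) (with_proj H2)" if "card Q = 2" "card (?X N) = 1"
  proof -
    have "{v \<in> {4, 5 :: nat}. (if v = 4 then {0, 1, 2} else {1, 2, 3}) = {0, 1, 2 :: nat}} = {4}"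
      using nbr_sets_distinct(3) by (auto simp only: split: if_splits)
    then have cX: "card (?X N) = card {v \<in> {4, 5 :: nat}. (if v = 4 then {0, 1, 2} else {1, 2, 3}) = {0, 1, 2 :: nat}}"
      using that(2) by (simp only: card.empty card_insert_disjoint finite.emptyI) simp
    show ?thesis
    proof (rule path_clique_iso_two_types[OF G.pair_wf_digraph H2.pair_wf_digraph pc path_clique_H2 fin _ _ N _ cX])
      show "card Q = card {4, 5 :: nat}" using that(1) by simp
    qed simp_all
  qed
  have H3: "digraph_iso (with_proj G) (with_proj H3)"
    if "path_clique G 3 u' Q N'" "card Q = 3" "card (?X N') = 2"
      "\<And>v. v \<in> Q \<Longrightarrow> N' v = {0, 1, 2} \<or> N' v = {1, 2, 3}" for u' N'
  proof -
    have "{v \<in> {1, 2, 5 :: nat}. (if v = 5 then {1, 2, 3} else {0, 1, 2}) = {0, 1, 2 :: nat}} = {1, 2}"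
      using nbr_sets_distinct(3) by (auto simp only: split: if_splits)
    then have cX: "card (?X N') = card {v \<in> {1, 2, 5 :: nat}. (if v = 5 then {1, 2, 3} else {0, 1, 2}) = {0, 1, 2 :: nat}}"
      using that(3) by (simp only: card.empty card_insert_disjoint finite.emptyI) simp
    show ?thesis
    proof (rule path_clique_iso_two_types[OF G.pair_wf_digraph H3.pair_wf_digraph that(1) path_clique_H3 fin _ _ that(4) _ cX])
      show "card Q = card {1, 2, 5 :: nat}" using that(2) by simp
    qed simp_all
  qed
  have "card {v} \<le> card (?X N)" using fin v by (intro card_mono) simp_all
  then have X1: "1 \<le> card (?X N)" by simp
  have "N w \<noteq> {0, 1, 2}" using w(2) nbr_sets_distinct(3) by (simp only:) simp
  then have "?X N \<subset> Q" using w(1) by blast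
  then have X2: "card (?X N) < card Q" by (rule psubset_card_mono[OF fin])
  consider "card Q = 2" "card (?X N) = 1" | "card Q = 3" "card (?X N) = 2" | "card Q = 3" "card (?X N) = 1"
    using Q2 Q3 X1 X2 by linarith
  then show ?thesis
  proof cases
    case 1
    then show ?thesis using H2 by (simp add: extremal_class_def)
  next
    case 2
    then show ?thesis using H3[OF pc] N by (simp add: extremal_class_def)
  next
    \<comment> \<open>\<open>H3\<close> has two vertices attached at the left and one at the right;
      reversing the path swaps the two types.\<close>
    case 3
    let ?N' = "\<lambda>v. (\<lambda>j. 3 - j) ` N v"
    have a: "(\<lambda>j. 3 - j) ` {0, 1, 2 :: nat} = {1, 2, 3}" and b: "(\<lambda>j. 3 - j) ` {1, 2, 3 :: nat} = {0, 1, 2}"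
      by (simp_all add: insert_commute)
    have N': "N v = {0, 1, 2} \<and> ?N' v = {1, 2, 3} \<or> N v = {1, 2, 3} \<and> ?N' v = {0, 1, 2}" if "v \<in> Q" for v
      using N[OF that] a b by metis
    have "?N' v = {0, 1, 2} \<longleftrightarrow> N v \<noteq> {0, 1, 2}" if "v \<in> Q" for v
      using N'[OF that] nbr_sets_distinct(3) by metis
    then have "?X ?N' = {v \<in> Q. N v \<noteq> {0, 1, 2}}" by (intro Collect_cong conj_cong refl)
    moreover have "{v \<in> Q. \<not> P v} = Q - {v \<in> Q. P v}" for P by blast
    moreover have "card (Q - ?X N) = 2" using 3 fin by (simp add: card_Diff_subset)
    ultimately have "card (?X ?N') = 2" by (simp only:)
    then have "digraph_iso (with_proj G) (with_proj H3)"
      using N' 3(1) by (intro H3[OF path_clique_reverse[OF pc]]) metis+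
    then show ?thesis using 3 by (simp add: extremal_class_def)
  qed
qed

section \<open>The characterisation\<close>

lemma (in pair_graph) exists_diametral:
  assumes conn: "Digraph_Component.connected (with_proj G)"
    and D: "graph_diameter (with_proj G) = D" "3 \<le> D" and ne: "pverts G \<noteq> {}"
  shows "\<exists>u. diametral (pverts G) (gdist G) D u"
proof -
  interpret graph_metric "pverts G" "gdist G" using graph_metric_gdist[OF conn] .
  have Dm: "D = Max (ec ` pverts G)" using D by (simp add: graph_diameter_def ecc_def ec_def[abs_def])
  then have "D \<in> ec ` pverts G" using finite_V ne by (simp del: Max_in add: Max_in[of "ec ` pverts G"])
  then obtain x where x: "x \<in> pverts G" "ec x = D" by auto
  then obtain y where y: "y \<in> pverts G" "gdist G x y = D" using ec_attained by metis
  then obtain u where u: "\<And>j. j \<le> D \<Longrightarrow> u j \<in> pverts G"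
      "\<And>i j. i \<le> j \<Longrightarrow> j \<le> D \<Longrightarrow> gdist G (u i) (u j) = j - i"
    using exists_geodesic[OF x(1) y(1)] by auto
  have le: "gdist G a b \<le> D" if "a \<in> pverts G" "b \<in> pverts G" for a b
  proof -
    have "ec a \<le> D" unfolding Dm using finite_V that by simp
    then show ?thesis using d_le_ec[OF that(2), of a] by linarith
  qed
  have "diametral (pverts G) (gdist G) D u"
    using D(2) u le by unfold_locales
  then show ?thesis by blast
qed

text \<open>Three cases: all attachments at the left end, all at the right end, which reversal
  reduces to the first, or both ends, which forces \<open>D = 3\<close> and three path neighbours
  for every remaining vertex.\<close>

lemma (in pair_graph) index_eq_imp_iso_extremal:
  assumes conn: "Digraph_Component.connected (with_proj G)" and dia: "diametral (pverts G) (gdist G) D u"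
    and eq: "ecc_conn_index (with_proj G) = f_max (card (pverts G)) D"
  shows "\<exists>H\<in>extremal_class (card (pverts G)) D. digraph_iso (with_proj G) (with_proj H)"
proof -
  interpret diametral "pverts G" "gdist G" D u by (rule dia)
  define n where "n = card (pverts G)"
  have Dn: "D < n" and m: "m = n - D - 1" using card_V by (simp_all add: n_def)
  have G: "pair_graph G" by unfold_locales
  let ?A = "two_nbr_bound D m" and ?B = "three_nbr_bound D m"
  have xi: "xi = path_index D + m * rest_bound D m"
    using eq ecc_conn_index_eq_xi[OF conn] f_max_eq[OF D3 Dn] m by (simp add: n_def)
  note ext = xi_eq_imp[OF xi]
  have clique: "gdist G v w = 1" if "v \<in> rest" "w \<in> rest" "v \<noteq> w" for v w
    using ext[OF that(1)] that by blast
  have N: "N v = {0, 1} \<and> ?B \<le> ?A \<and> ec v = D \<or> N v = {0, 1, 2} \<and> ?A \<le> ?B \<or>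
      N v = {D - 1, D} \<and> ?B \<le> ?A \<and> ec v = D \<or> N v = {D - 2, D - 1, D} \<and> ?A \<le> ?B"
    if "v \<in> rest" for v
  proof -
    have "rest_bound D m = ?A \<longleftrightarrow> ?B \<le> ?A" "rest_bound D m = ?B \<longleftrightarrow> ?A \<le> ?B"
      by (auto simp: rest_bound_def)
    then show ?thesis using ext[OF that] by argo
  qed
  have pc: "path_clique G D u rest N"
    unfolding path_clique_def
  proof (intro conjI ballI allI impI)
    show "inj_on u {..D}" by (rule inj_u)
    show "pverts G = u ` {..D} \<union> rest" by (rule V_eq)
    show "u ` {..D} \<inter> rest = {}" by (auto simp: rest_def)
    show "N v \<subseteq> {..D}" for v by (auto simp: N_def)
    show "(u i, u j) \<in> parcs G \<longleftrightarrow> i = Suc j \<or> j = Suc i" if "i \<le> D" "j \<le> D" for i j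
      using gdist_eq_1_iff[OF conn u_in[OF that(1)] u_in[OF that(2)]] d_u[OF that] by auto
    show arc: "(v, u j) \<in> parcs G \<longleftrightarrow> j \<in> N v" if "v \<in> rest" "j \<le> D" for v j
      using gdist_eq_1_iff[OF conn rest_in[OF that(1)] u_in[OF that(2)]] that by (simp add: N_def)
    show "(u j, v) \<in> parcs G \<longleftrightarrow> j \<in> N v" if "v \<in> rest" "j \<le> D" for v j
      using arc[OF that] arcs_symmetric by blast
    show "(v, w) \<in> parcs G \<longleftrightarrow> v \<noteq> w" if "v \<in> rest" "w \<in> rest" for v w
      using gdist_eq_1_iff[OF conn rest_in[OF that(1)] rest_in[OF that(2)]] clique[OF that]
        no_loops'[of v w] by blast
  qed
  have cardQ: "card rest = n - D - 1" using m by (simp add: m_def)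
  have "\<exists>H\<in>extremal_class n D. digraph_iso (with_proj G) (with_proj H)"
  \<comment> \<open>Membership of 0 marks attachment at the left, since the windows at the right end
    start at \<open>D - 2\<close> or later.\<close>
  proof (cases "\<forall>v\<in>rest. 0 \<in> N v")
    case True
    show ?thesis
    proof (rule one_sided_iso[OF G D3 Dn pc finite_rest cardQ])
      fix v assume v: "v \<in> rest"
      have "0 \<notin> {D - 1, D}" "0 \<notin> {D - 2, D - 1, D}" using D3 by auto
      then have "N v \<noteq> {D - 1, D}" "N v \<noteq> {D - 2, D - 1, D}" using True v by metis+
      then show "N v = {0, 1} \<and> three_nbr_bound D (n - D - 1) \<le> two_nbr_bound D (n - D - 1) \<or>
          N v = {0, 1, 2} \<and> two_nbr_bound D (n - D - 1) \<le> three_nbr_bound D (n - D - 1)"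
        using N[OF v] m by metis
    qed
  next
    case False
    then obtain w where w: "w \<in> rest" "0 \<notin> N w" by blast
    have right: "N x = {D - 1, D} \<and> ?B \<le> ?A \<or> N x = {D - 2, D - 1, D} \<and> ?A \<le> ?B"
      if "x \<in> rest" "0 \<notin> N x" for x
      using N[OF that(1)] that(2) by (metis insertI1)
    show ?thesis
    proof (cases "\<exists>v\<in>rest. 0 \<in> N v")
      case False
      have im2: "(\<lambda>j. D - j) ` {D - 1, D} = {0, 1}" and im3: "(\<lambda>j. D - j) ` {D - 2, D - 1, D} = {0, 1, 2}"
        using D3 by (simp_all add: insert_commute)
      show ?thesis
      proof (rule one_sided_iso[OF G D3 Dn path_clique_reverse[OF pc] finite_rest cardQ])
        fix v assume v: "v \<in> rest"
        then show "(\<lambda>j. D - j) ` N v = {0, 1} \<and> three_nbr_bound D (n - D - 1) \<le> two_nbr_bound D (n - D - 1) \<or>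
            (\<lambda>j. D - j) ` N v = {0, 1, 2} \<and> two_nbr_bound D (n - D - 1) \<le> three_nbr_bound D (n - D - 1)"
          using right[OF v] False im2 im3 m by metis
      qed
    next
      case True
      then obtain v where v: "v \<in> rest" "0 \<in> N v" by blast
      have vw: "gdist G v w = 1" using clique v w by blast
      have DN: "D \<in> N w" using right[OF w] by auto
      \<comment> \<open>\<open>v\<close> is adjacent to \<open>u 0\<close> and \<open>w\<close> to
        \<open>u D\<close>; by the clique property \<open>x\<close> is within distance 1 of
        both.\<close>
      have to_ends: "gdist G x (u 0) \<le> 2 \<and> gdist G x (u D) \<le> 2" if x: "x \<in> rest" for x
      proof -
        have "gdist G x v \<le> 1" "gdist G x w \<le> 1"
          using clique[OF x v(1)] clique[OF x w(1)] d_self[OF rest_in[OF x]] by (cases "x = v"; cases "x = w"; simp)+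
        then show ?thesis
          using d_triangle[OF rest_in[OF x] rest_in[OF v(1)] u_in, of 0] N_d[OF v(2)]
            d_triangle[OF rest_in[OF x] rest_in[OF w(1)] u_in, of D] N_d[OF DN] by simp
      qed
      \<comment> \<open>The route from \<open>u 0\<close> through \<open>v\<close> to
        \<open>u D\<close> has length at most \<open>1 + 2\<close>.\<close>
      have D: "D = 3"
        using d_triangle[OF u_in rest_in[OF v(1)] u_in, of 0 D] d_u[of 0 D] N_d[OF v(2)] to_ends[OF v(1)]
          d_commute[OF u_in rest_in[OF v(1)], of 0] D3 by simp
      \<comment> \<open>This excludes the alternatives with two path neighbours, which demand
        eccentricity \<open>D = 3\<close>.\<close>
      have ec2: "ec x \<le> 2" if x: "x \<in> rest" for x
      proof -
        have "1 \<in> N x \<or> 2 \<in> N x" using N[OF x] D by auto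
        then have mid: "gdist G x (u 1) \<le> 2" "gdist G x (u 2) \<le> 2"
          using d_rest_u_le[OF x, of 1 1] d_rest_u_le[OF x, of 1 2] d_rest_u_le[OF x, of 2 1]
            d_rest_u_le[OF x, of 2 2] D by auto
        have "gdist G x y \<le> 2" if "y \<in> pverts G" for y
          using that
        proof (cases rule: V_cases)
          case (path j)
          then have "j = 0 \<or> j = 1 \<or> j = 2 \<or> j = D" using D by linarith
          then show ?thesis using path mid to_ends[OF x] by auto
        next
          case rest
          then show ?thesis using clique[OF x, of y] d_self[OF rest_in[OF x]] by (cases "x = y") simp_all
        qed
        then show ?thesis using ec_attained[OF rest_in[OF x]] by metis
      qed
      have D123: "{D - 2, D - 1, D} = {1, 2, 3}" using D by simp
      have N3: "N x = {0, 1, 2} \<or> N x = {1, 2, 3}" and AB: "?A \<le> ?B" if x: "x \<in> rest" for x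
      proof -
        have "ec x \<noteq> D" using ec2[OF x] D by simp
        then show "N x = {0, 1, 2} \<or> N x = {1, 2, 3}" "?A \<le> ?B" using N[OF x] D123 by metis+
      qed
      \<comment> \<open>Three path neighbours are optimal for \<open>D = 3\<close> only up to this
        order, which leaves at most three remaining vertices.\<close>
      have "n \<le> 7" using AB[OF v(1)] three_le_two_iff(2)[OF D3 Dn] m D by simp
      then have c3: "card rest \<le> 3" and c4: "card rest + 4 = n" using cardQ D Dn by simp_all
      have "0 \<notin> {1, 2, 3 :: nat}" by simp
      then have Nv: "N v = {0, 1, 2}" and Nw: "N w = {1, 2, 3}"
        using N3[OF v(1)] N3[OF w(1)] v(2) w(2) by (metis, metis insertI1)
      have "path_clique G 3 u rest N"
        by (rule subst[OF D, where P = "\<lambda>l. path_clique G l u rest N", OF pc])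
      then have "\<exists>H\<in>extremal_class (card rest + 4) 3. digraph_iso (with_proj G) (with_proj H)"
        by (rule two_sided_iso[OF G _ finite_rest N3 v(1) Nv w(1) Nw c3])
      moreover have "extremal_class (card rest + 4) 3 = extremal_class n D" using c4 D by metis
      ultimately show ?thesis by (simp only:)
    qed
  qed
  then show ?thesis by (simp only: n_def)
qed

theorem theorem4:
  fixes G :: "'a pair_pre_digraph" and n D :: nat
  assumes "pair_graph G"
    and "Digraph_Component.connected (with_proj G)"
    and "card (pverts G) = n" and "n \<ge> 4"
    and "graph_diameter (with_proj G) = D" and "3 \<le> D" and "D \<le> n - 1"
  shows "ecc_conn_index (with_proj G) \<le> f_max n D \<and>
    (ecc_conn_index (with_proj G) = f_max n D \<longleftrightarrow>
      (\<exists>H \<in> extremal_class n D. digraph_iso (with_proj G) (with_proj H)))"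
proof -
  interpret G: pair_graph G by fact
  have Dn: "D < n" using assms(4,7) by simp
  obtain u where dia: "diametral (pverts G) (gdist G) D u"
    using G.exists_diametral[OF assms(2,5,6)] assms(3,4) by fastforce
  interpret diametral "pverts G" "gdist G" D u by (rule dia)
  have "m = n - D - 1" using card_V assms(3) by simp
  then have "ecc_conn_index (with_proj G) \<le> f_max n D"
    using xi_le G.ecc_conn_index_eq_xi[OF assms(2)] f_max_eq[OF assms(6) Dn] by simp
  moreover have "\<exists>H \<in> extremal_class n D. digraph_iso (with_proj G) (with_proj H)"
    if "ecc_conn_index (with_proj G) = f_max n D"
    using G.index_eq_imp_iso_extremal[OF assms(2) dia] that assms(3) by simp
  ultimately show ?thesis
    using iso_extremal_class_imp_index[OF assms(1,6) Dn] by blast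
qed

end
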